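(* Let $n\ge 1$. The free DMV-algebra over $n$ generators is (up to isomorphism) the algebra of all functions from $[0,1]^n$ to $[0,1]$ that are continuous, piecewise linear and such that each linear piece has rational coefficients, with operations defined pointwise.
   Context: An MV-algebra is a structure $(A,\oplus,\neg,0,1)$ satisfying: $x\oplus(y\oplus z)=(x\oplus y)\oplus z$; $x\oplus y=y\oplus x$; $x\oplus 0=x$; $x\oplus 1=1$; $\neg 0=1$; $\neg 1=0$; $\neg(\neg x\oplus y)\oplus y=\neg(\neg y\oplus x)\oplus x$. One sets $x\odot y=\neg(\neg x\oplus\neg y)$. For $x\in A$ and $m\ge 0$, $m.x\in A$ is defined by $0.x=0$ and $m.x=(m-1).x\oplus x$. A DMV-algebra is a structure $A=(A,\oplus,\neg,\{\delta_m\}_{m\ge 1},0,1)$, each $\delta_m$ being a unary operation, such that $(A,\oplus,\neg,0,1)$ is an MV-algebra and for every $x\in A$ and every integer $m\ge 1$: $m.\delta_m x=x$ and $\delta_m x\odot (m-1).\delta_m x=0$. Homomorphisms preserve $\oplus,\neg,0,1$ and all $\delta_m$; "free" is meant in the variety of DMV-algebras. The pointwise operations are $(f\oplus g)(\mathbf{x})=\min\{1,f(\mathbf{x})+g(\mathbf{x})\}$, $(\neg f)(\mathbf{x})=1-f(\mathbf{x})$, $(\delta_m f)(\mathbf{x})=f(\mathbf{x})/m$, with the constant functions $0$ and $1$. A continuous $f:[0,1]^n\to[0,1]$ is piecewise linear with rational coefficients if there are finitely many affine functions $p_1,\dots,p_k$, each of the form $p_i(\mathbf{x})=b_i+\sum_{j=1}^n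 a_{ij}x_j$ with $a_{ij},b_i\in\mathbb{Q}$, such that for every $\mathbf{x}\in[0,1]^n$ there is $i$ with $f(\mathbf{x})=p_i(\mathbf{x})$. *)

theory Defs
  imports "HOL-Analysis.Analysis" "HOL-Algebra.Congruence"
begin

record 'a mv = "'a partial_object" +
  mv_plus :: "'a \<Rightarrow> 'a \<Rightarrow> 'a" (infixl "\<oplus>\<index>" 65)
  mv_neg :: "'a \<Rightarrow> 'a" ("\<sim>\<index> _" [81] 80)
  mv_zero :: 'a ("\<zero>\<index>")
  mv_one :: 'a ("\<one>\<index>")

definition mv_odot :: "('a, 'm) mv_scheme \<Rightarrow> 'a \<Rightarrow> 'a \<Rightarrow> 'a" (infixl "\<odot>\<index>" 70)
  where "x \<odot>\<^bsub>A\<^esub> y = \<sim>\<^bsub>A\<^esub> (\<sim>\<^bsub>A\<^esub> x \<oplus>\<^bsub>A\<^esub> \<sim>\<^bsub>A\<^esub> y)"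

primrec mv_mult :: "('a, 'm) mv_scheme \<Rightarrow> nat \<Rightarrow> 'a \<Rightarrow> 'a" where
  "mv_mult A 0 x = \<zero>\<^bsub>A\<^esub>"
| "mv_mult A (Suc m) x = mv_mult A m x \<oplus>\<^bsub>A\<^esub> x"

locale mv_algebra =
  fixes A :: "('a, 'm) mv_scheme" (structure)
  assumes zero_closed: "\<zero> \<in> carrier A"
    and one_closed: "\<one> \<in> carrier A"
    and neg_closed: "x \<in> carrier A \<Longrightarrow> \<sim> x \<in> carrier A"
    and plus_closed: "\<lbrakk>x \<in> carrier A; y \<in> carrier A\<rbrakk> \<Longrightarrow> x \<oplus> y \<in> carrier A"
    and plus_assoc:
      "\<lbrakk>x \<in> carrier A; y \<in> carrier A; z \<in> carrier A\<rbrakk> \<Longrightarrow> x \<oplus> (y \<oplus> z) = (x \<oplus> y) \<oplus> z"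
    and plus_comm: "\<lbrakk>x \<in> carrier A; y \<in> carrier A\<rbrakk> \<Longrightarrow> x \<oplus> y = y \<oplus> x"
    and plus_zero: "x \<in> carrier A \<Longrightarrow> x \<oplus> \<zero> = x"
    and plus_one: "x \<in> carrier A \<Longrightarrow> x \<oplus> \<one> = \<one>"
    and neg_zero: "\<sim> \<zero> = \<one>"
    and neg_one: "\<sim> \<one> = \<zero>"
    and lukasiewicz:
      "\<lbrakk>x \<in> carrier A; y \<in> carrier A\<rbrakk> \<Longrightarrow> \<sim> (\<sim> x \<oplus> y) \<oplus> y = \<sim> (\<sim> y \<oplus> x) \<oplus> x"

text \<open>The operations \<open>\<delta>\<close> are indexed by the integers \<open>m \<ge> 1\<close>; the value of the field at index
  \<open>0\<close> is unconstrained, and it is ignored by all notions below.\<close>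

record 'a dmv = "'a mv" +
  dmv_delta :: "nat \<Rightarrow> 'a \<Rightarrow> 'a" ("\<delta>\<index>")

locale dmv_algebra = mv_algebra A
  for A :: "('a, 'm) dmv_scheme" (structure) +
  assumes delta_closed: "\<lbrakk>m \<ge> 1; x \<in> carrier A\<rbrakk> \<Longrightarrow> \<delta> m x \<in> carrier A"
    and mult_delta: "\<lbrakk>m \<ge> 1; x \<in> carrier A\<rbrakk> \<Longrightarrow> mv_mult A m (\<delta> m x) = x"
    and delta_odot: "\<lbrakk>m \<ge> 1; x \<in> carrier A\<rbrakk> \<Longrightarrow> \<delta> m x \<odot> mv_mult A (m - 1) (\<delta> m x) = \<zero>"

definition dmv_hom :: "('a, 'm) dmv_scheme \<Rightarrow> ('b, 'k) dmv_scheme \<Rightarrow> ('a \<Rightarrow> 'b) set" where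
  "dmv_hom A B = {h \<in> carrier A \<rightarrow> carrier B.
     (\<forall>x\<in>carrier A. \<forall>y\<in>carrier A. h (x \<oplus>\<^bsub>A\<^esub> y) = h x \<oplus>\<^bsub>B\<^esub> h y) \<and>
     (\<forall>x\<in>carrier A. h (\<sim>\<^bsub>A\<^esub> x) = \<sim>\<^bsub>B\<^esub> h x) \<and>
     h \<zero>\<^bsub>A\<^esub> = \<zero>\<^bsub>B\<^esub> \<and> h \<one>\<^bsub>A\<^esub> = \<one>\<^bsub>B\<^esub> \<and>
     (\<forall>m\<ge>1. \<forall>x\<in>carrier A. h (\<delta>\<^bsub>A\<^esub> m x) = \<delta>\<^bsub>B\<^esub> m (h x))}"

definition dmv_iso :: "('a, 'm) dmv_scheme \<Rightarrow> ('b, 'k) dmv_scheme \<Rightarrow> bool" where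
  "dmv_iso A B \<longleftrightarrow> (\<exists>h \<in> dmv_hom A B. bij_betw h (carrier A) (carrier B))"

text \<open>The free algebra in the variety of DMV-algebras over the generators \<open>'v\<close>: terms in the
  variables \<open>'v\<close> modulo the congruence generated by all instances of the defining equations.
  Its universal property is proved below. \<open>TDelta k t\<close> stands for \<open>\<delta>\<^bsub>k+1\<^esub> t\<close>, so that there
  is no term for an operation of index \<open>0\<close>.\<close>

datatype 'v dmv_term =
    TVar 'v
  | TZero
  | TOne
  | TNeg "'v dmv_term"
  | TPlus "'v dmv_term" "'v dmv_term"
  | TDelta nat "'v dmv_term"

definition term_dmv :: "'v dmv_term dmv" where
  "term_dmv = \<lparr>carrier = UNIV, mv_plus = TPlus, mv_neg = TNeg, mv_zero = TZero, mv_one = TOne,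
     dmv_delta = (\<lambda>m. TDelta (m - 1))\<rparr>"

inductive dmv_eq :: "'v dmv_term \<Rightarrow> 'v dmv_term \<Rightarrow> bool" (infix "\<approx>\<^sub>d" 50) where
  refl: "s \<approx>\<^sub>d s"
| sym: "s \<approx>\<^sub>d t \<Longrightarrow> t \<approx>\<^sub>d s"
| trans: "s \<approx>\<^sub>d t \<Longrightarrow> t \<approx>\<^sub>d u \<Longrightarrow> s \<approx>\<^sub>d u"
| cong_neg: "s \<approx>\<^sub>d t \<Longrightarrow> TNeg s \<approx>\<^sub>d TNeg t"
| cong_plus: "s \<approx>\<^sub>d t \<Longrightarrow> s' \<approx>\<^sub>d t' \<Longrightarrow> TPlus s s' \<approx>\<^sub>d TPlus t t'"
| cong_delta: "s \<approx>\<^sub>d t \<Longrightarrow> TDelta k s \<approx>\<^sub>d TDelta k t"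
| assoc: "TPlus s (TPlus t u) \<approx>\<^sub>d TPlus (TPlus s t) u"
| comm: "TPlus s t \<approx>\<^sub>d TPlus t s"
| zero: "TPlus s TZero \<approx>\<^sub>d s"
| one: "TPlus s TOne \<approx>\<^sub>d TOne"
| neg_zero: "TNeg TZero \<approx>\<^sub>d TOne"
| neg_one: "TNeg TOne \<approx>\<^sub>d TZero"
| lukasiewicz: "TPlus (TNeg (TPlus (TNeg s) t)) t \<approx>\<^sub>d TPlus (TNeg (TPlus (TNeg t) s)) s"
| mult_delta: "m \<ge> 1 \<Longrightarrow> mv_mult term_dmv m (\<delta>\<^bsub>term_dmv\<^esub> m s) \<approx>\<^sub>d s"
| delta_odot: "m \<ge> 1 \<Longrightarrow>
    \<delta>\<^bsub>term_dmv\<^esub> m s \<odot>\<^bsub>term_dmv\<^esub> mv_mult term_dmv (m - 1) (\<delta>\<^bsub>term_dmv\<^esub> m s) \<approx>\<^sub>d TZero"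

definition tclass :: "'v dmv_term \<Rightarrow> 'v dmv_term set" where
  "tclass s = {t. s \<approx>\<^sub>d t}"

definition free_dmv :: "'v dmv_term set dmv" where
  "free_dmv = \<lparr>carrier = range tclass,
     mv_plus = (\<lambda>X Y. \<Union>s\<in>X. \<Union>t\<in>Y. tclass (TPlus s t)),
     mv_neg = (\<lambda>X. \<Union>s\<in>X. tclass (TNeg s)),
     mv_zero = tclass TZero,
     mv_one = tclass TOne,
     dmv_delta = (\<lambda>m X. \<Union>s\<in>X. tclass (\<delta>\<^bsub>term_dmv\<^esub> m s))\<rparr>"

lemma tclass_eq_iff: "tclass s = tclass t \<longleftrightarrow> s \<approx>\<^sub>d t"
  unfolding tclass_def using dmv_eq.refl dmv_eq.sym dmv_eq.trans by blast

lemma free_dmv_simps: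
  "carrier free_dmv = range tclass"
  "\<zero>\<^bsub>free_dmv\<^esub> = tclass TZero"
  "\<one>\<^bsub>free_dmv\<^esub> = tclass TOne"
  "\<sim>\<^bsub>free_dmv\<^esub> (tclass s) = tclass (TNeg s)"
  "tclass s \<oplus>\<^bsub>free_dmv\<^esub> tclass t = tclass (TPlus s t)"
  "\<delta>\<^bsub>free_dmv\<^esub> m (tclass s) = tclass (TDelta (m - 1) s)"
proof -
  have un: "(\<Union>s'\<in>tclass s. tclass (F s')) = tclass (F s)"
    if "\<And>s'. s \<approx>\<^sub>d s' \<Longrightarrow> F s \<approx>\<^sub>d F s'" for F :: "'v dmv_term \<Rightarrow> 'v dmv_term" and s
  proof -
    have "tclass (F s') = tclass (F s)" if "s' \<in> tclass s" for s'
      using that \<open>\<And>s'. s \<approx>\<^sub>d s' \<Longrightarrow> F s \<approx>\<^sub>d F s'\<close>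
      by (metis mem_Collect_eq tclass_def tclass_eq_iff)
    moreover have "s \<in> tclass s" by (simp add: tclass_def dmv_eq.refl)
    ultimately show ?thesis by blast
  qed
  show "\<sim>\<^bsub>free_dmv\<^esub> (tclass s) = tclass (TNeg s)"
    by (simp add: free_dmv_def un dmv_eq.cong_neg)
  show "\<delta>\<^bsub>free_dmv\<^esub> m (tclass s) = tclass (TDelta (m - 1) s)"
    by (simp add: free_dmv_def term_dmv_def un dmv_eq.cong_delta)
  have "(\<Union>s'\<in>tclass s. \<Union>t'\<in>tclass t. tclass (TPlus s' t')) =
      (\<Union>s'\<in>tclass s. tclass (TPlus s' t))"
    by (simp add: un dmv_eq.cong_plus dmv_eq.refl)
  also have "\<dots> = tclass (TPlus s t)"
    by (rule un) (simp add: dmv_eq.cong_plus dmv_eq.refl)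
  finally show "tclass s \<oplus>\<^bsub>free_dmv\<^esub> tclass t = tclass (TPlus s t)"
    by (simp add: free_dmv_def)
qed (simp_all add: free_dmv_def)

lemma mv_mult_free_dmv: "mv_mult free_dmv m (tclass s) = tclass (mv_mult term_dmv m s)"
  by (induction m) (simp_all add: free_dmv_simps, simp_all add: term_dmv_def)

lemma dmv_algebra_free_dmv: "dmv_algebra (free_dmv :: 'v dmv_term set dmv)"
proof
  fix m :: nat and x :: "'v dmv_term set"
  assume m: "m \<ge> 1" and "x \<in> carrier free_dmv"
  then obtain s where s: "x = tclass s" by (auto simp: free_dmv_simps)
  have d: "TDelta (m - 1) s = \<delta>\<^bsub>term_dmv\<^esub> m s" by (simp add: term_dmv_def)
  show "\<delta>\<^bsub>free_dmv\<^esub> m x \<in> carrier free_dmv" by (simp add: s free_dmv_simps)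
  show "mv_mult free_dmv m (\<delta>\<^bsub>free_dmv\<^esub> m x) = x"
    unfolding s free_dmv_simps d mv_mult_free_dmv tclass_eq_iff using m by (rule dmv_eq.mult_delta)
  have "\<delta>\<^bsub>term_dmv\<^esub> m s \<odot>\<^bsub>term_dmv\<^esub> mv_mult term_dmv (m - 1) (\<delta>\<^bsub>term_dmv\<^esub> m s) \<approx>\<^sub>d TZero"
    using m by (rule dmv_eq.delta_odot)
  then have "TNeg (TPlus (TNeg (\<delta>\<^bsub>term_dmv\<^esub> m s))
      (TNeg (mv_mult term_dmv (m - 1) (\<delta>\<^bsub>term_dmv\<^esub> m s)))) \<approx>\<^sub>d TZero"
    by (simp add: mv_odot_def term_dmv_def)
  then show "\<delta>\<^bsub>free_dmv\<^esub> m x \<odot>\<^bsub>free_dmv\<^esub> mv_mult free_dmv (m - 1) (\<delta>\<^bsub>free_dmv\<^esub> m x) = \<zero>\<^bsub>free_dmv\<^esub>"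
    unfolding s free_dmv_simps d mv_mult_free_dmv mv_odot_def tclass_eq_iff .
qed (auto simp: free_dmv_simps tclass_eq_iff del: equalityI intro: rangeI dmv_eq.assoc dmv_eq.comm
    dmv_eq.zero dmv_eq.one dmv_eq.neg_zero dmv_eq.neg_one dmv_eq.lukasiewicz)

primrec term_val :: "('a, 'm) dmv_scheme \<Rightarrow> ('v \<Rightarrow> 'a) \<Rightarrow> 'v dmv_term \<Rightarrow> 'a" where
  "term_val B g (TVar v) = g v"
| "term_val B g TZero = \<zero>\<^bsub>B\<^esub>"
| "term_val B g TOne = \<one>\<^bsub>B\<^esub>"
| "term_val B g (TNeg s) = \<sim>\<^bsub>B\<^esub> term_val B g s"
| "term_val B g (TPlus s t) = term_val B g s \<oplus>\<^bsub>B\<^esub> term_val B g t"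
| "term_val B g (TDelta k s) = \<delta>\<^bsub>B\<^esub> (Suc k) (term_val B g s)"

context dmv_algebra
begin

lemma term_val_closed: "range g \<subseteq> carrier A \<Longrightarrow> term_val A g s \<in> carrier A"
  by (induction s) (auto intro: zero_closed one_closed neg_closed plus_closed delta_closed)

lemma term_val_mult: "term_val A g (mv_mult term_dmv m s) = mv_mult A m (term_val A g s)"
  by (induction m) (simp_all add: term_dmv_def)

lemma term_val_sound:
  assumes g: "range g \<subseteq> carrier A"
  shows "s \<approx>\<^sub>d t \<Longrightarrow> term_val A g s = term_val A g t"
proof (induction rule: dmv_eq.induct)
  case (mult_delta m s)
  have "term_val A g (\<delta>\<^bsub>term_dmv\<^esub> m s) = \<delta> m (term_val A g s)"
    using mult_delta by (simp add: term_dmv_def)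
  then show ?case
    using mult_delta by (simp add: term_val_mult dmv_algebra.mult_delta[OF dmv_algebra_axioms] term_val_closed[OF g])
next
  case (delta_odot m s)
  have d: "term_val A g (\<delta>\<^bsub>term_dmv\<^esub> m s) = \<delta> m (term_val A g s)"
    using delta_odot by (simp add: term_dmv_def)
  have o: "term_val A g (u \<odot>\<^bsub>term_dmv\<^esub> w) = term_val A g u \<odot> term_val A g w" for u w
    by (simp add: mv_odot_def term_dmv_def)
  show ?case
    using dmv_algebra.delta_odot[OF dmv_algebra_axioms delta_odot term_val_closed[OF g]] by (simp add: o d term_val_mult)
next
  case (comm s t)
  then show ?case by (simp add: plus_comm term_val_closed[OF g])
qed (simp_all add: term_val_closed[OF g] plus_assoc plus_zero plus_one neg_zero neg_one
      lukasiewicz[of "term_val A g _" "term_val A g _"])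

end

theorem free_dmv_universal:
  fixes B :: "('b, 'k) dmv_scheme" and g :: "'v \<Rightarrow> 'b"
  assumes "dmv_algebra B" and g: "range g \<subseteq> carrier B"
  shows "\<exists>!h. h \<in> dmv_hom free_dmv B \<and> h \<in> extensional (carrier free_dmv) \<and>
    (\<forall>v. h (tclass (TVar v)) = g v)"
proof -
  interpret B: dmv_algebra B by fact
  define h where "h = restrict (\<lambda>X. term_val B g (SOME s. X = tclass s)) (carrier free_dmv)"
  have h: "h (tclass s) = term_val B g s" for s
  proof -
    have "tclass s = tclass (SOME s'. tclass s = tclass s')" by (rule someI) simp
    then have "term_val B g s = term_val B g (SOME s'. tclass s = tclass s')"
      by (intro B.term_val_sound g) (simp only: tclass_eq_iff[symmetric])
    then show ?thesis by (simp add: h_def free_dmv_simps)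
  qed
  have ext: "h \<in> extensional (carrier free_dmv)" by (simp add: h_def)
  show ?thesis
  proof (intro ex1I[of _ h] conjI allI)
    show "h \<in> dmv_hom free_dmv B"
      by (auto simp: dmv_hom_def free_dmv_simps h B.term_val_closed[OF g])
    show "h \<in> extensional (carrier free_dmv)" by (rule ext)
    show "h (tclass (TVar v)) = g v" for v by (simp add: h)
  next
    fix h' assume h': "h' \<in> dmv_hom free_dmv B \<and> h' \<in> extensional (carrier free_dmv) \<and>
      (\<forall>v. h' (tclass (TVar v)) = g v)"
    then have "h' (\<delta>\<^bsub>free_dmv\<^esub> (Suc k) (tclass s)) = \<delta>\<^bsub>B\<^esub> (Suc k) (h' (tclass s))" for k s
      unfolding dmv_hom_def by (auto simp: free_dmv_simps(1))
    then have dl: "h' (tclass (TDelta k s)) = \<delta>\<^bsub>B\<^esub> (Suc k) (h' (tclass s))" for k s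
      by (simp add: free_dmv_simps)
    have "h' (tclass s) = term_val B g s" for s
      by (induction s) (use h' dl in \<open>auto simp: dmv_hom_def free_dmv_simps\<close>)
    then show "h' = h"
      using h' ext
      by (intro extensionalityI[of _ "carrier free_dmv"]) (auto simp: h free_dmv_simps(1))
  qed
qed

text \<open>A function with domain \<open>[0,1]\<^sup>n\<close> is represented by an extensional function on
  \<open>real^'n\<close>, where \<open>n = CARD('n)\<close>.\<close>

abbreviation unit_cube :: "(real^'n) set" where
  "unit_cube \<equiv> cbox 0 1"

definition rational_pwl :: "(real^'n \<Rightarrow> real) \<Rightarrow> bool" where
  "rational_pwl f \<longleftrightarrow> (\<exists>(k::nat) (a :: nat \<Rightarrow> 'n \<Rightarrow> rat) (b :: nat \<Rightarrow> rat).
     \<forall>x\<in>unit_cube. \<exists>i<k. f x = of_rat (b i) + (\<Sum>j\<in>UNIV. of_rat (a i j) * x $ j))"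

definition pwl_dmv :: "(real^'n \<Rightarrow> real) dmv" where
  "pwl_dmv =
    \<lparr>carrier = {f \<in> unit_cube \<rightarrow>\<^sub>E {0..1}. continuous_on unit_cube f \<and> rational_pwl f},
     mv_plus = (\<lambda>f g. \<lambda>x\<in>unit_cube. min 1 (f x + g x)),
     mv_neg = (\<lambda>f. \<lambda>x\<in>unit_cube. 1 - f x),
     mv_zero = (\<lambda>x\<in>unit_cube. 0),
     mv_one = (\<lambda>x\<in>unit_cube. 1),
     dmv_delta = (\<lambda>m f. \<lambda>x\<in>unit_cube. f x / real m)\<rparr>"

end

theory Submission imports Defs begin

text \<open>The isomorphism sends the class of a term \<open>t\<close> to the function \<open>[0,1]\<^sup>n \<rightarrow> [0,1]\<close> that evaluates
  \<open>t\<close> in the unit interval, viewed as a DMV-algebra. It is well defined because the unit interval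
  satisfies the axioms, and its values are continuous rational piecewise linear functions by
  induction on terms. Two things have to be shown.

  \<^emph>\<open>Injectivity\<close> is a completeness theorem (\<open>dmv_completeness\<close>): an equation that holds in
  \<open>[0,1]\<close> follows from the axioms. An element \<open>a \<noteq> 0\<close> of a DMV-algebra avoids some prime ideal;
  since \<open>\<delta>\<^sub>m x\<close> is determined by \<open>x\<close> in a totally ordered quotient, the quotient is again a DMV-algebra,
  and so \<open>a\<close> stays nonzero in some DMV-chain (\<open>chain_separation\<close>). A chain need not be archimedean,
  so it has no useful map to \<open>[0,1]\<close>, but evaluating one term involves only finitely many elements,
  and any finite part of a chain embeds into \<open>[0,1]\<close> (\<open>chain_local_embedding\<close>). The usual proof
  of this builds the ordered group around the chain. Divisibility gives a shortcut: after
  applying \<open>\<delta>\<^sub>m\<close> with \<open>m\<close> large, any fixed number of elements can be added without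
  truncation, so that the chain itself says which of two formal sums of its elements is
  the larger one. For any two given formal sums these comparisons are compatible with addition
  once \<open>m\<close> is large, and Fourier-Motzkin elimination uses this only for finitely many sums, which
  are determined before \<open>m\<close> is chosen. Elimination then yields real numbers for which the same
  comparisons hold (\<open>sign_realization\<close>).

  \<^emph>\<open>Surjectivity\<close> is the rational version of McNaughton's theorem (\<open>pwl_definable\<close>). A continuous
  function \<open>f\<close> with affine pieces \<open>p\<^sub>i\<close> on a convex set is a maximum of minima of pieces: on the
  segment between any two points \<open>x\<close> and \<open>y\<close> some piece passes from at most \<open>f x\<close> to at
  least \<open>f y\<close> (\<open>affine_selection\<close>), so the minimum of the pieces with \<open>p\<^sub>i y \<ge> f y\<close> lies
  below \<open>f\<close> everywhere and touches it at \<open>y\<close>. Maxima and minima are term operations, and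
  division makes the truncation of an affine function to \<open>[0,1]\<close> easy to
  express: shrunk by a large factor and shifted by \<open>1/2\<close>, the function can be summed term by term
  without truncation, and a multiple of its excess over \<open>1/2\<close> is what is wanted
  (\<open>definable_clamp_affine\<close>).\<close>

section \<open>The order and truncated subtraction of an MV-algebra\<close>

context mv_algebra
begin

declare zero_closed [simp, intro] one_closed [simp, intro] neg_closed [simp, intro]
  plus_closed [simp, intro] plus_zero [simp] plus_one [simp] neg_zero [simp] neg_one [simp]

definition mv_le :: "'a \<Rightarrow> 'a \<Rightarrow> bool" (infix "\<sqsubseteq>" 50)
  where "x \<sqsubseteq> y \<longleftrightarrow> \<sim> x \<oplus> y = \<one>"

text \<open>In \<open>[0,1]\<close> this is \<open>max 0 (x - y)\<close>. Residuation (\<open>minus_le_iff\<close>) is immediate from this form,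
  and most of the arithmetic below is derived from it.\<close>

definition mv_minus :: "'a \<Rightarrow> 'a \<Rightarrow> 'a" (infixl "\<ominus>" 65)
  where "x \<ominus> y = \<sim> (\<sim> x \<oplus> y)"

lemma minus_closed [simp, intro]: "x \<in> carrier A \<Longrightarrow> y \<in> carrier A \<Longrightarrow> x \<ominus> y \<in> carrier A"
  by (simp add: mv_minus_def)

lemma mult_closed [simp, intro]: "x \<in> carrier A \<Longrightarrow> mv_mult A m x \<in> carrier A"
  by (induction m) auto

lemma plus_assoc':
  "x \<in> carrier A \<Longrightarrow> y \<in> carrier A \<Longrightarrow> z \<in> carrier A \<Longrightarrow> (x \<oplus> y) \<oplus> z = x \<oplus> (y \<oplus> z)"
  by (simp add: plus_assoc)

lemma plus_left_comm:
  "x \<in> carrier A \<Longrightarrow> y \<in> carrier A \<Longrightarrow> z \<in> carrier A \<Longrightarrow> x \<oplus> (y \<oplus> z) = y \<oplus> (x \<oplus> z)"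
  by (metis plus_assoc plus_comm)

lemmas plus_ac = plus_assoc' plus_comm plus_left_comm

lemma zero_plus [simp]: "x \<in> carrier A \<Longrightarrow> \<zero> \<oplus> x = x"
  by (metis plus_comm plus_zero zero_closed)

lemma one_plus [simp]: "x \<in> carrier A \<Longrightarrow> \<one> \<oplus> x = \<one>"
  by (metis plus_comm plus_one one_closed)

lemma neg_neg [simp]: "x \<in> carrier A \<Longrightarrow> \<sim> (\<sim> x) = x"
  using lukasiewicz[of x \<zero>] by simp

lemma plus_neg [simp]: "x \<in> carrier A \<Longrightarrow> x \<oplus> \<sim> x = \<one>"
  using lukasiewicz[of x \<one>] plus_comm[of x "\<sim> x"] by simp

lemma le_refl [simp]: "x \<in> carrier A \<Longrightarrow> x \<sqsubseteq> x"
  by (metis mv_le_def neg_closed plus_comm plus_neg)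

lemma le_plusI:
  assumes "x \<in> carrier A" "z \<in> carrier A" shows "x \<sqsubseteq> x \<oplus> z"
  using assms le_refl[of x] by (simp add: mv_le_def plus_assoc)

text \<open>Both sides of the Lukasiewicz axiom are the join of \<open>x\<close> and \<open>y\<close>.\<close>

lemma le_minus_plus:
  assumes "x \<in> carrier A" "y \<in> carrier A" "x \<sqsubseteq> y" shows "(y \<ominus> x) \<oplus> x = y"
  using assms lukasiewicz[of x y] by (simp add: mv_le_def mv_minus_def)

lemma le_iff_plus:
  assumes "x \<in> carrier A" "y \<in> carrier A"
  shows "x \<sqsubseteq> y \<longleftrightarrow> (\<exists>z\<in>carrier A. y = x \<oplus> z)"
  using le_minus_plus[OF assms] le_plusI[of x] assms
  by (metis minus_closed plus_comm)

lemma le_antisym: "x \<in> carrier A \<Longrightarrow> y \<in> carrier A \<Longrightarrow> x \<sqsubseteq> y \<Longrightarrow> y \<sqsubseteq> x \<Longrightarrow> x = y"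
  using lukasiewicz[of x y] by (simp add: mv_le_def)

lemma le_trans:
  assumes "x \<in> carrier A" "y \<in> carrier A" "z \<in> carrier A" "x \<sqsubseteq> y" "y \<sqsubseteq> z" shows "x \<sqsubseteq> z"
proof -
  obtain u v where "u \<in> carrier A" "v \<in> carrier A" "y = x \<oplus> u" "z = y \<oplus> v"
    using assms by (auto simp: le_iff_plus)
  then show ?thesis using assms by (simp add: plus_assoc' le_plusI)
qed

lemma zero_le [simp]: "x \<in> carrier A \<Longrightarrow> \<zero> \<sqsubseteq> x"
  by (simp add: mv_le_def)

lemma le_one [simp]: "x \<in> carrier A \<Longrightarrow> x \<sqsubseteq> \<one>"
  by (simp add: mv_le_def)

lemma le_zero_iff [simp]: "x \<in> carrier A \<Longrightarrow> x \<sqsubseteq> \<zero> \<longleftrightarrow> x = \<zero>"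
  using le_antisym[of x \<zero>] by auto

lemma neg_le_neg: "x \<in> carrier A \<Longrightarrow> y \<in> carrier A \<Longrightarrow> \<sim> x \<sqsubseteq> \<sim> y \<longleftrightarrow> y \<sqsubseteq> x"
  by (simp add: mv_le_def plus_comm[of x])

lemma plus_mono:
  assumes "x \<in> carrier A" "y \<in> carrier A" "u \<in> carrier A" "v \<in> carrier A" "x \<sqsubseteq> u" "y \<sqsubseteq> v"
  shows "x \<oplus> y \<sqsubseteq> u \<oplus> v"
proof -
  obtain a b where "a \<in> carrier A" "b \<in> carrier A" "u = x \<oplus> a" "v = y \<oplus> b"
    using assms by (auto simp: le_iff_plus)
  moreover from this have "u \<oplus> v = (x \<oplus> y) \<oplus> (a \<oplus> b)" using assms by (simp add: plus_ac)
  ultimately show ?thesis using assms by (auto simp: le_plusI)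
qed

lemma minus_le_iff:
  "x \<in> carrier A \<Longrightarrow> y \<in> carrier A \<Longrightarrow> z \<in> carrier A \<Longrightarrow> x \<ominus> y \<sqsubseteq> z \<longleftrightarrow> x \<sqsubseteq> y \<oplus> z"
  by (simp add: mv_minus_def mv_le_def plus_assoc')

lemma minus_le: "x \<in> carrier A \<Longrightarrow> y \<in> carrier A \<Longrightarrow> x \<ominus> y \<sqsubseteq> x"
  by (simp add: minus_le_iff plus_comm[of y] le_plusI)

lemma minus_eq_zero_iff: "x \<in> carrier A \<Longrightarrow> y \<in> carrier A \<Longrightarrow> x \<ominus> y = \<zero> \<longleftrightarrow> x \<sqsubseteq> y"
  using minus_le_iff[of x y \<zero>] by simp

text \<open>The relation \<open>x \<sqsubseteq> \<sim> y\<close> says that the sum \<open>x \<oplus> y\<close> is not truncated: in \<open>[0,1]\<close> it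
  means \<open>x + y \<le> 1\<close>. The next lemmas show that untruncated sums behave like sums in a cancellative
  ordered monoid.\<close>

lemma orth_sym: "x \<in> carrier A \<Longrightarrow> y \<in> carrier A \<Longrightarrow> x \<sqsubseteq> \<sim> y \<longleftrightarrow> y \<sqsubseteq> \<sim> x"
  by (simp add: mv_le_def plus_comm[of "\<sim> x"])

lemma odot_eq_zero_iff:
  "x \<in> carrier A \<Longrightarrow> y \<in> carrier A \<Longrightarrow> x \<odot> y = \<zero> \<longleftrightarrow> x \<sqsubseteq> \<sim> y"
  using neg_neg[of "\<sim> x \<oplus> \<sim> y"] by (auto simp: mv_odot_def mv_le_def simp del: neg_neg)

lemma plus_minus_cancel:
  assumes "x \<in> carrier A" "z \<in> carrier A" "x \<sqsubseteq> \<sim> z" shows "(x \<oplus> z) \<ominus> z = x"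
proof -
  have "(\<sim> x \<ominus> z) \<oplus> z = \<sim> x" using assms by (intro le_minus_plus) (auto simp: orth_sym)
  then have "\<sim> (x \<oplus> z) \<oplus> z = \<sim> x" using assms by (simp add: mv_minus_def)
  then show ?thesis using assms by (simp add: mv_minus_def)
qed

text \<open>Subtracting \<open>z\<close> undoes the untruncated sum \<open>x \<oplus> z\<close> exactly and takes \<open>y \<oplus> z\<close> to at most \<open>y\<close>.\<close>

lemma plus_le_cancel:
  assumes "x \<in> carrier A" "y \<in> carrier A" "z \<in> carrier A" "x \<sqsubseteq> \<sim> z" "x \<oplus> z \<sqsubseteq> y \<oplus> z"
  shows "x \<sqsubseteq> y"
proof -
  have "(x \<oplus> z) \<ominus> z \<sqsubseteq> y" using assms by (simp add: minus_le_iff plus_comm[of z])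
  then show ?thesis using assms by (simp add: plus_minus_cancel)
qed

lemma orth_assoc:
  assumes "a \<in> carrier A" "b \<in> carrier A" "c \<in> carrier A" "a \<sqsubseteq> \<sim> b" "a \<oplus> b \<sqsubseteq> \<sim> c"
  shows "a \<sqsubseteq> \<sim> (b \<oplus> c)"
proof -
  have "c \<sqsubseteq> \<sim> (a \<oplus> b)" using assms orth_sym[of "a \<oplus> b" c] by simp
  then have "b \<oplus> c \<sqsubseteq> b \<oplus> \<sim> (a \<oplus> b)" using assms by (intro plus_mono) auto
  also have "b \<oplus> \<sim> (a \<oplus> b) = (\<sim> a \<ominus> b) \<oplus> b"
    using assms by (simp add: mv_minus_def plus_comm)
  also have "\<dots> = \<sim> a" using assms by (intro le_minus_plus) (auto simp: orth_sym)
  finally show ?thesis using assms orth_sym[of a "b \<oplus> c"] by simp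
qed

lemma orth_assoc':
  assumes "a \<in> carrier A" "b \<in> carrier A" "c \<in> carrier A" "b \<sqsubseteq> \<sim> c" "a \<sqsubseteq> \<sim> (b \<oplus> c)"
  shows "a \<oplus> b \<sqsubseteq> \<sim> c"
  using orth_assoc[of c b a] orth_sym[of a "b \<oplus> c"] orth_sym[of b c] orth_sym[of "a \<oplus> b" c] assms
  by (simp add: plus_comm)

lemma mult_add: "x \<in> carrier A \<Longrightarrow> mv_mult A (i + j) x = mv_mult A i x \<oplus> mv_mult A j x"
  by (induction j) (simp_all add: plus_assoc)

lemma mult_plus:
  "x \<in> carrier A \<Longrightarrow> y \<in> carrier A \<Longrightarrow> mv_mult A m (x \<oplus> y) = mv_mult A m x \<oplus> mv_mult A m y"
  by (induction m) (simp_all add: plus_ac)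

lemma mult_zero [simp]: "mv_mult A m \<zero> = \<zero>"
  by (induction m) auto

lemma mult_mono:
  "x \<in> carrier A \<Longrightarrow> y \<in> carrier A \<Longrightarrow> x \<sqsubseteq> y \<Longrightarrow> mv_mult A m x \<sqsubseteq> mv_mult A m y"
  by (induction m) (auto intro: plus_mono)

lemma mult_mono2: "x \<in> carrier A \<Longrightarrow> i \<le> j \<Longrightarrow> mv_mult A i x \<sqsubseteq> mv_mult A j x"
  using mult_add[of x i "j - i"] by (auto simp: le_plusI)

lemma minus_mono: "x \<in> carrier A \<Longrightarrow> y \<in> carrier A \<Longrightarrow> z \<in> carrier A \<Longrightarrow> x \<sqsubseteq> y \<Longrightarrow> x \<ominus> z \<sqsubseteq> y \<ominus> z"
  using plus_mono[of "\<sim> y" z "\<sim> x" z] by (simp add: mv_minus_def neg_le_neg)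

lemma minus_plus_least:
  assumes "x \<in> carrier A" "y \<in> carrier A" "z \<in> carrier A" "x \<sqsubseteq> z" "y \<sqsubseteq> z"
  shows "(x \<ominus> y) \<oplus> y \<sqsubseteq> z"
  using plus_mono[of "x \<ominus> y" y "z \<ominus> y" y] minus_mono[of x z y] le_minus_plus[of y z] assms by simp

text \<open>The two differences are what remains of \<open>x\<close> and \<open>y\<close> above their meet \<open>m\<close>. If \<open>z\<close> is below both,
  then \<open>m \<oplus> z\<close> is a lower bound of \<open>x\<close> and \<open>y\<close>, hence at most \<open>m\<close>, and \<open>z\<close> cancels to \<open>\<zero>\<close>.\<close>

lemma minus_disjoint:
  assumes "x \<in> carrier A" "y \<in> carrier A" "z \<in> carrier A" "z \<sqsubseteq> x \<ominus> y" "z \<sqsubseteq> y \<ominus> x"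
  shows "z = \<zero>"
proof -
  \<comment> \<open>the meet of \<open>x\<close> and \<open>y\<close>, in both of its forms\<close>
  define m where "m = x \<ominus> (x \<ominus> y)"
  have m: "m \<in> carrier A" using assms by (simp add: m_def)
  have m': "m = y \<ominus> (y \<ominus> x)"
    using assms lukasiewicz[of "\<sim> x" "\<sim> y"]
    by (simp add: m_def mv_minus_def plus_comm)
  have mx: "m \<oplus> z \<sqsubseteq> x"
    using assms m plus_mono[of m z m "x \<ominus> y"] by (simp add: m_def le_minus_plus minus_le)
  have my: "m \<oplus> z \<sqsubseteq> y"
    using assms m plus_mono[of m z m "y \<ominus> x"] by (simp add: m' le_minus_plus minus_le)
  have "(\<sim> y \<ominus> \<sim> x) \<oplus> \<sim> x \<sqsubseteq> \<sim> (m \<oplus> z)"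
    using assms m mx my by (intro minus_plus_least) (auto simp: neg_le_neg)
  moreover have "(\<sim> y \<ominus> \<sim> x) \<oplus> \<sim> x = \<sim> m"
    using assms by (simp add: m_def mv_minus_def plus_comm)
  ultimately have "z \<oplus> m \<sqsubseteq> \<zero> \<oplus> m" using assms m by (simp add: neg_le_neg plus_comm)
  moreover have "z \<sqsubseteq> \<sim> m"
  proof -
    have "x \<ominus> y \<sqsubseteq> \<sim> y"
      using assms by (simp add: minus_le_iff)
    moreover have "m \<sqsubseteq> y" using assms by (simp add: m' minus_le)
    ultimately show ?thesis using assms m
      by (meson le_trans minus_closed neg_closed neg_le_neg)
  qed
  ultimately show ?thesis
    using assms m plus_le_cancel[of z \<zero> m] by simp
qed

end

section \<open>Prime ideals\<close>

context mv_algebra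
begin

definition disjoint :: "'a \<Rightarrow> 'a \<Rightarrow> bool" where
  "disjoint x y \<longleftrightarrow> (\<forall>z\<in>carrier A. z \<sqsubseteq> x \<longrightarrow> z \<sqsubseteq> y \<longrightarrow> z = \<zero>)"

lemma disjointD: "disjoint x y \<Longrightarrow> z \<in> carrier A \<Longrightarrow> z \<sqsubseteq> x \<Longrightarrow> z \<sqsubseteq> y \<Longrightarrow> z = \<zero>"
  by (simp add: disjoint_def)

lemma disjoint_plus:
  assumes "x \<in> carrier A" "y \<in> carrier A" "y' \<in> carrier A" "disjoint x y" "disjoint x y'"
  shows "disjoint x (y \<oplus> y')"
  unfolding disjoint_def
proof (intro ballI impI)
  fix z assume z: "z \<in> carrier A" "z \<sqsubseteq> x" "z \<sqsubseteq> y \<oplus> y'"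
  then have "z \<ominus> y \<sqsubseteq> y'" using assms by (simp add: minus_le_iff)
  moreover have "z \<ominus> y \<sqsubseteq> x" using assms z by (meson le_trans minus_closed minus_le)
  ultimately have "z \<ominus> y = \<zero>" using assms z by (intro disjointD[of x y']) auto
  then show "z = \<zero>" using assms z by (intro disjointD[of x y]) (auto simp: minus_eq_zero_iff)
qed

lemma disjoint_mult:
  assumes "x \<in> carrier A" "y \<in> carrier A" "disjoint x y" shows "disjoint x (mv_mult A m y)"
proof (induction m)
  case 0
  then show ?case by (simp add: disjoint_def)
next
  case (Suc m)
  then show ?case using assms by (simp add: disjoint_plus)
qed

lemma disjoint_sym: "disjoint x y \<Longrightarrow> disjoint y x"
  by (auto simp: disjoint_def)

definition mv_ideal :: "'a set \<Rightarrow> bool" where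
  "mv_ideal I \<longleftrightarrow> I \<subseteq> carrier A \<and> \<zero> \<in> I \<and> (\<forall>x\<in>I. \<forall>y\<in>I. x \<oplus> y \<in> I) \<and>
     (\<forall>x\<in>I. \<forall>y\<in>carrier A. y \<sqsubseteq> x \<longrightarrow> y \<in> I)"

lemma mv_idealD:
  assumes "mv_ideal I"
  shows "I \<subseteq> carrier A" "\<zero> \<in> I" "x \<in> I \<Longrightarrow> y \<in> I \<Longrightarrow> x \<oplus> y \<in> I"
    "x \<in> I \<Longrightarrow> y \<in> carrier A \<Longrightarrow> y \<sqsubseteq> x \<Longrightarrow> y \<in> I"
  using assms by (simp_all add: mv_ideal_def)

lemma mv_ideal_mult: "mv_ideal I \<Longrightarrow> x \<in> I \<Longrightarrow> mv_mult A m x \<in> I"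
  by (induction m) (auto simp: mv_ideal_def)

text \<open>This is the ideal generated by \<open>I\<close> and \<open>u\<close>, described explicitly.\<close>

lemma mv_ideal_adjoin:
  assumes I: "mv_ideal I" and u: "u \<in> carrier A"
  defines "J \<equiv> {z \<in> carrier A. \<exists>i\<in>I. \<exists>m. z \<sqsubseteq> i \<oplus> mv_mult A m u}"
  shows "mv_ideal J" "I \<subseteq> J" "u \<in> J"
proof -
  have Ic: "I \<subseteq> carrier A" and I0: "\<zero> \<in> I" using I by (auto simp: mv_ideal_def)
  show "I \<subseteq> J"
  proof
    fix x assume "x \<in> I"
    then show "x \<in> J" using Ic u unfolding J_def
      by (auto intro!: bexI[of _ x] exI[of _ 0])
  qed
  show "u \<in> J" using Ic I0 u unfolding J_def
    by (auto intro!: bexI[of _ \<zero>] exI[of _ 1])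
  show "mv_ideal J"
    unfolding mv_ideal_def
  proof (intro conjI ballI impI)
    show "\<zero> \<in> J" using \<open>I \<subseteq> J\<close> I0 by auto
    fix x y assume "x \<in> J" "y \<in> J"
    then obtain i m j n where xy: "x \<in> carrier A" "y \<in> carrier A"
      and h: "i \<in> I" "j \<in> I" "x \<sqsubseteq> i \<oplus> mv_mult A m u" "y \<sqsubseteq> j \<oplus> mv_mult A n u"
      unfolding J_def by auto
    have "x \<oplus> y \<sqsubseteq> (i \<oplus> mv_mult A m u) \<oplus> (j \<oplus> mv_mult A n u)"
      using h xy Ic u by (intro plus_mono) auto
    also have "\<dots> = (i \<oplus> j) \<oplus> mv_mult A (m + n) u"
      using h Ic u by (simp add: mult_add plus_ac subset_iff)
    finally have "x \<oplus> y \<sqsubseteq> (i \<oplus> j) \<oplus> mv_mult A (m + n) u" .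
    moreover have "i \<oplus> j \<in> I" using I h by (simp add: mv_ideal_def)
    ultimately show "x \<oplus> y \<in> J" using xy unfolding J_def by blast
  next
    fix x y assume "x \<in> J" "y \<in> carrier A" "y \<sqsubseteq> x"
    then obtain i m where "i \<in> I" "x \<in> carrier A" "x \<sqsubseteq> i \<oplus> mv_mult A m u"
      unfolding J_def by auto
    moreover from this have "y \<sqsubseteq> i \<oplus> mv_mult A m u"
      using Ic u \<open>y \<in> carrier A\<close> \<open>y \<sqsubseteq> x\<close> le_trans[of y x "i \<oplus> mv_mult A m u"] by auto
    ultimately show "y \<in> J" unfolding J_def using \<open>y \<in> carrier A\<close> by blast
  qed (auto simp: J_def)
qed

text \<open>Modulo \<open>I\<close>, the element \<open>a\<close> is below multiples of two disjoint elements, and such multiples are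
  disjoint as well.\<close>

lemma mv_ideal_split:
  assumes I: "mv_ideal I" and xy: "x \<in> carrier A" "y \<in> carrier A" "a \<in> carrier A"
    and i: "i \<in> I" "a \<sqsubseteq> i \<oplus> mv_mult A m (x \<ominus> y)"
    and j: "j \<in> I" "a \<sqsubseteq> j \<oplus> mv_mult A n (y \<ominus> x)"
  shows "a \<in> I"
proof -
  have c: "i \<in> carrier A" "j \<in> carrier A" and ij: "i \<oplus> j \<in> I" using I i j by (auto simp: mv_ideal_def)
  have "disjoint (x \<ominus> y) (y \<ominus> x)" using xy minus_disjoint by (auto simp: disjoint_def)
  then have d: "disjoint (mv_mult A m (x \<ominus> y)) (mv_mult A n (y \<ominus> x))"
    using disjoint_mult[OF _ _ disjoint_sym[OF disjoint_mult[OF _ _ disjoint_sym]]] xy by simp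
  have "a \<ominus> (i \<oplus> j) \<sqsubseteq> mv_mult A m (x \<ominus> y)"
  proof -
    have "i \<oplus> mv_mult A m (x \<ominus> y) \<sqsubseteq> (i \<oplus> j) \<oplus> mv_mult A m (x \<ominus> y)"
      using c xy by (intro plus_mono) (auto simp: le_plusI)
    then show ?thesis using i c xy le_trans[OF _ _ _ i(2)] by (simp add: minus_le_iff)
  qed
  moreover have "a \<ominus> (i \<oplus> j) \<sqsubseteq> mv_mult A n (y \<ominus> x)"
  proof -
    have "j \<oplus> mv_mult A n (y \<ominus> x) \<sqsubseteq> (i \<oplus> j) \<oplus> mv_mult A n (y \<ominus> x)"
      using c xy by (intro plus_mono) (auto simp: le_plusI plus_comm[of i])
    then show ?thesis using j c xy le_trans[OF _ _ _ j(2)] by (simp add: minus_le_iff)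
  qed
  ultimately have "a \<ominus> (i \<oplus> j) = \<zero>" using c xy by (intro disjointD[OF d]) auto
  then have "a \<sqsubseteq> i \<oplus> j" using c xy by (simp add: minus_eq_zero_iff)
  then show ?thesis using I ij xy by (auto simp: mv_ideal_def)
qed

text \<open>By Zorn's lemma there is an ideal \<open>P\<close> that is maximal among those avoiding \<open>a\<close>. If neither
  \<open>x \<ominus> y\<close> nor \<open>y \<ominus> x\<close> were in \<open>P\<close>, then adjoining either of them would capture \<open>a\<close>, and \<open>a\<close> would be
  in \<open>P\<close> by the previous lemma.\<close>

lemma prime_ideal_exists:
  assumes a: "a \<in> carrier A" "a \<noteq> \<zero>"
  obtains P where "mv_ideal P" "a \<notin> P"
    "\<And>x y. x \<in> carrier A \<Longrightarrow> y \<in> carrier A \<Longrightarrow> x \<ominus> y \<in> P \<or> y \<ominus> x \<in> P"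
proof -
  define \<I> where "\<I> = {I. mv_ideal I \<and> a \<notin> I}"
  have "{\<zero>} \<in> \<I>" using a by (auto simp: \<I>_def mv_ideal_def)
  moreover have "\<Union>\<C> \<in> \<I>" if "\<C> \<noteq> {}" "subset.chain \<I> \<C>" for \<C>
  proof -
    have C: "mv_ideal I" "a \<notin> I" if "I \<in> \<C>" for I
      using that \<open>subset.chain \<I> \<C>\<close> by (auto simp: \<I>_def subset.chain_def)
    have "x \<oplus> y \<in> \<Union>\<C>" if xy: "x \<in> \<Union>\<C>" "y \<in> \<Union>\<C>" for x y
    proof -
      obtain I J where IJ: "I \<in> \<C>" "J \<in> \<C>" "x \<in> I" "y \<in> J" using xy by auto
      then have "I \<subseteq> J \<or> J \<subseteq> I" using \<open>subset.chain \<I> \<C>\<close> by (auto simp: subset.chain_def)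
      then obtain K where "K \<in> \<C>" "x \<in> K" "y \<in> K" using IJ by blast
      then show ?thesis using mv_idealD(3)[OF C(1)] by blast
    qed
    moreover have "\<zero> \<in> \<Union>\<C>" using that mv_idealD(2)[OF C(1)] by blast
    moreover have "\<Union>\<C> \<subseteq> carrier A" using mv_idealD(1)[OF C(1)] by blast
    moreover have "y \<in> \<Union>\<C>" if "x \<in> \<Union>\<C>" "y \<in> carrier A" "y \<sqsubseteq> x" for x y
      using that mv_idealD(4)[OF C(1)] by blast
    ultimately show ?thesis using C(2) unfolding \<I>_def mv_ideal_def by blast
  qed
  ultimately obtain P where P: "P \<in> \<I>" "\<And>X. X \<in> \<I> \<Longrightarrow> P \<subseteq> X \<Longrightarrow> X = P"
    using subset_Zorn_nonempty[of \<I>] by blast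
  have PI: "mv_ideal P" "a \<notin> P" using P by (auto simp: \<I>_def)
  have adj: "\<exists>i\<in>P. \<exists>m. a \<sqsubseteq> i \<oplus> mv_mult A m u" if u: "u \<in> carrier A" "u \<notin> P" for u
    using mv_ideal_adjoin[OF PI(1) u(1)] P(2) u a unfolding \<I>_def by blast
  have "x \<ominus> y \<in> P \<or> y \<ominus> x \<in> P" if "x \<in> carrier A" "y \<in> carrier A" for x y
    using adj[of "x \<ominus> y"] adj[of "y \<ominus> x"] mv_ideal_split[OF PI(1) that a(1)] PI(2) that by blast
  then show ?thesis using that PI by blast
qed

end

section \<open>The quotient by a prime ideal is a chain\<close>

context mv_algebra
begin

text \<open>An element \<open>a\<close> whose \<open>m\<close>-fold sum is untruncated is determined by this sum, up to an error
  controlled by \<open>i\<close> and \<open>j\<close>: replacing \<open>m - 1\<close> of the \<open>m\<close> copies of \<open>b\<close> by the larger \<open>a\<close> and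
  cancelling them leaves a comparison of one \<open>a\<close> with one \<open>b\<close>. The error terms are there so that the
  lemma applies modulo an ideal; they are \<open>\<zero>\<close> when it is used in a chain.\<close>

lemma exact_part_le:
  assumes c: "a \<in> carrier A" "b \<in> carrier A" "i \<in> carrier A" "j \<in> carrier A" and m: "m \<ge> 1"
    and ex: "a \<sqsubseteq> \<sim> (mv_mult A (m - 1) a)"
    and le: "mv_mult A m a \<sqsubseteq> mv_mult A m b \<oplus> i" and ba: "b \<sqsubseteq> a \<oplus> j"
  shows "a \<sqsubseteq> b \<oplus> (mv_mult A (m - 1) j \<oplus> i)"
proof -
  obtain k where k: "m = Suc k" using m by (cases m) auto
  have "mv_mult A k b \<sqsubseteq> mv_mult A k a \<oplus> mv_mult A k j"
    using mult_mono[of b "a \<oplus> j" k] c ba by (simp add: mult_plus)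
  then have "(mv_mult A k b \<oplus> b) \<oplus> i \<sqsubseteq> ((mv_mult A k a \<oplus> mv_mult A k j) \<oplus> b) \<oplus> i"
    using c by (intro plus_mono) auto
  also have "\<dots> = (b \<oplus> (mv_mult A k j \<oplus> i)) \<oplus> mv_mult A k a"
    using c by (simp add: plus_ac)
  finally have "a \<oplus> mv_mult A k a \<sqsubseteq> (b \<oplus> (mv_mult A k j \<oplus> i)) \<oplus> mv_mult A k a"
    using le c k le_trans[of "a \<oplus> mv_mult A k a" "(mv_mult A k b \<oplus> b) \<oplus> i"]
    by (simp add: plus_comm[of a])
  then show ?thesis
    using c ex k plus_le_cancel[of a "b \<oplus> (mv_mult A k j \<oplus> i)" "mv_mult A k a"] by simp
qed

text \<open>The condition \<open>x \<ominus> y \<in> P\<close> is the order of the quotient by \<open>P\<close>; this form of it is the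
  convenient one for adding inequalities.\<close>

lemma le_mod_ideal_iff:
  assumes P: "mv_ideal P" and c: "x \<in> carrier A" "y \<in> carrier A"
  shows "x \<ominus> y \<in> P \<longleftrightarrow> (\<exists>i\<in>P. x \<sqsubseteq> y \<oplus> i)"
proof
  assume "x \<ominus> y \<in> P"
  moreover have "x \<sqsubseteq> y \<oplus> (x \<ominus> y)" using c minus_le_iff[of x y "x \<ominus> y"] by simp
  ultimately show "\<exists>i\<in>P. x \<sqsubseteq> y \<oplus> i" by blast
next
  assume "\<exists>i\<in>P. x \<sqsubseteq> y \<oplus> i"
  then obtain i where "i \<in> P" "x \<sqsubseteq> y \<oplus> i" by blast
  then show "x \<ominus> y \<in> P" using mv_idealD[OF P] c by (metis minus_closed minus_le_iff subsetD)
qed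

lemma le_mod_ideal_trans:
  assumes P: "mv_ideal P" and c: "x \<in> carrier A" "y \<in> carrier A" "z \<in> carrier A"
    and "x \<ominus> y \<in> P" "y \<ominus> z \<in> P"
  shows "x \<ominus> z \<in> P"
proof -
  obtain i j where ij: "i \<in> P" "x \<sqsubseteq> y \<oplus> i" "j \<in> P" "y \<sqsubseteq> z \<oplus> j"
    using assms by (auto simp: le_mod_ideal_iff)
  have ijc: "i \<in> carrier A" "j \<in> carrier A" using ij mv_idealD(1)[OF P] by auto
  have "y \<oplus> i \<sqsubseteq> (z \<oplus> j) \<oplus> i" using c ij ijc by (intro plus_mono) auto
  then have "x \<sqsubseteq> z \<oplus> (j \<oplus> i)"
    using c ij ijc le_trans[of x "y \<oplus> i" "z \<oplus> (j \<oplus> i)"] by (simp add: plus_assoc)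
  then show ?thesis using P c ij mv_idealD(3)[OF P] by (auto simp: le_mod_ideal_iff)
qed

lemma le_mod_ideal_plus:
  assumes P: "mv_ideal P"
    and c: "x \<in> carrier A" "y \<in> carrier A" "u \<in> carrier A" "v \<in> carrier A"
    and "x \<ominus> u \<in> P" "y \<ominus> v \<in> P"
  shows "(x \<oplus> y) \<ominus> (u \<oplus> v) \<in> P"
proof -
  obtain i j where ij: "i \<in> P" "x \<sqsubseteq> u \<oplus> i" "j \<in> P" "y \<sqsubseteq> v \<oplus> j"
    using assms by (auto simp: le_mod_ideal_iff)
  have ijc: "i \<in> carrier A" "j \<in> carrier A" using ij mv_idealD(1)[OF P] by auto
  have "x \<oplus> y \<sqsubseteq> (u \<oplus> i) \<oplus> (v \<oplus> j)" using c ij ijc by (intro plus_mono) auto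
  also have "\<dots> = (u \<oplus> v) \<oplus> (i \<oplus> j)" using c ijc by (simp add: plus_ac)
  finally show ?thesis using P c ij mv_idealD(3)[OF P] by (auto simp: le_mod_ideal_iff)
qed

lemma neg_minus_neg: "x \<in> carrier A \<Longrightarrow> y \<in> carrier A \<Longrightarrow> \<sim> x \<ominus> \<sim> y = y \<ominus> x"
  by (simp add: mv_minus_def plus_comm)

end

context dmv_algebra
begin

declare delta_closed [simp, intro]

lemma delta_exact: "m \<ge> 1 \<Longrightarrow> x \<in> carrier A \<Longrightarrow> \<delta> m x \<sqsubseteq> \<sim> (mv_mult A (m - 1) (\<delta> m x))"
  using delta_odot[of m x] by (simp add: odot_eq_zero_iff)

text \<open>An ideal is defined by the MV-operations only, and it is primeness that makes it
  compatible with the division operations: modulo \<open>P\<close>, either \<open>\<delta> m x\<close> is already below \<open>\<delta> m y\<close>, or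
  it is above, in which case \<open>exact_part_le\<close> forces the two to agree.\<close>

lemma le_mod_ideal_delta:
  assumes P: "mv_ideal P"
    and prime: "\<And>x y. x \<in> carrier A \<Longrightarrow> y \<in> carrier A \<Longrightarrow> x \<ominus> y \<in> P \<or> y \<ominus> x \<in> P"
    and c: "x \<in> carrier A" "y \<in> carrier A" and m: "m \<ge> 1" and xy: "x \<ominus> y \<in> P"
  shows "\<delta> m x \<ominus> \<delta> m y \<in> P"
proof (cases "\<delta> m y \<ominus> \<delta> m x \<in> P")
  case True
  obtain i where i: "i \<in> P" "x \<sqsubseteq> y \<oplus> i" using P c xy by (auto simp: le_mod_ideal_iff)
  obtain j where j: "j \<in> P" "\<delta> m y \<sqsubseteq> \<delta> m x \<oplus> j"
    using P c True m le_mod_ideal_iff[OF P, of "\<delta> m y" "\<delta> m x"] by auto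
  have ijc: "i \<in> carrier A" "j \<in> carrier A" using i j mv_idealD(1)[OF P] by auto
  have "\<delta> m x \<sqsubseteq> \<delta> m y \<oplus> (mv_mult A (m - 1) j \<oplus> i)"
    using c m ijc i j by (intro exact_part_le delta_exact) (auto simp: mult_delta)
  moreover have "mv_mult A (m - 1) j \<oplus> i \<in> P"
    using i j by (intro mv_idealD(3)[OF P] mv_ideal_mult[OF P])
  ultimately show ?thesis using c m P le_mod_ideal_iff[OF P, of "\<delta> m x" "\<delta> m y"] by auto
next
  case False
  then show ?thesis using prime[of "\<delta> m x" "\<delta> m y"] c m by auto
qed

definition ideal_class :: "'a set \<Rightarrow> 'a \<Rightarrow> 'a set" where
  "ideal_class P x = {y \<in> carrier A. x \<ominus> y \<in> P \<and> y \<ominus> x \<in> P}"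

text \<open>The operations use arbitrary representatives; for a prime ideal the choice does not matter.\<close>

definition ideal_quotient :: "'a set \<Rightarrow> 'a set dmv" where
  "ideal_quotient P = (let rep = (\<lambda>X. SOME x. x \<in> X) in
     \<lparr>carrier = ideal_class P ` carrier A,
      mv_plus = (\<lambda>X Y. ideal_class P (rep X \<oplus> rep Y)),
      mv_neg = (\<lambda>X. ideal_class P (\<sim> (rep X))),
      mv_zero = ideal_class P \<zero>,
      mv_one = ideal_class P \<one>,
      dmv_delta = (\<lambda>m X. ideal_class P (\<delta> m (rep X)))\<rparr>)"

end

locale dmv_chain = dmv_algebra +
  assumes total: "x \<in> carrier A \<Longrightarrow> y \<in> carrier A \<Longrightarrow> x \<sqsubseteq> y \<or> y \<sqsubseteq> x"

context dmv_algebra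
begin

context
  fixes P
  assumes P: "mv_ideal P"
    and prime: "\<And>x y. x \<in> carrier A \<Longrightarrow> y \<in> carrier A \<Longrightarrow> x \<ominus> y \<in> P \<or> y \<ominus> x \<in> P"
begin

lemma ideal_class_eq_iff:
  assumes "x \<in> carrier A" "y \<in> carrier A"
  shows "ideal_class P x = ideal_class P y \<longleftrightarrow> x \<ominus> y \<in> P \<and> y \<ominus> x \<in> P"
proof
  assume "ideal_class P x = ideal_class P y"
  moreover have "x \<in> ideal_class P x"
    using assms mv_idealD(2)[OF P] minus_eq_zero_iff[of x x] by (simp add: ideal_class_def)
  ultimately show "x \<ominus> y \<in> P \<and> y \<ominus> x \<in> P" by (auto simp: ideal_class_def)
next
  assume "x \<ominus> y \<in> P \<and> y \<ominus> x \<in> P"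
  then show "ideal_class P x = ideal_class P y"
    using le_mod_ideal_trans[OF P] assms unfolding ideal_class_def by blast
qed

lemma ideal_class_rep:
  assumes "x \<in> carrier A"
  defines "r \<equiv> SOME y. y \<in> ideal_class P x"
  shows "r \<in> carrier A" "ideal_class P r = ideal_class P x" "x \<ominus> r \<in> P" "r \<ominus> x \<in> P"
proof -
  have "x \<in> ideal_class P x"
    using assms mv_idealD(2)[OF P] minus_eq_zero_iff[of x x] by (simp add: ideal_class_def)
  then have "r \<in> ideal_class P x" unfolding r_def by (rule someI)
  then show "r \<in> carrier A" "x \<ominus> r \<in> P" "r \<ominus> x \<in> P" by (auto simp: ideal_class_def)
  then show "ideal_class P r = ideal_class P x" using assms(1) ideal_class_eq_iff[of r x] by simp
qed

lemma ideal_quotient_simps: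
  "carrier (ideal_quotient P) = ideal_class P ` carrier A"
  "\<zero>\<^bsub>ideal_quotient P\<^esub> = ideal_class P \<zero>"
  "\<one>\<^bsub>ideal_quotient P\<^esub> = ideal_class P \<one>"
  by (simp_all add: ideal_quotient_def Let_def)

lemma ideal_quotient_plus:
  assumes "x \<in> carrier A" "y \<in> carrier A"
  shows "ideal_class P x \<oplus>\<^bsub>ideal_quotient P\<^esub> ideal_class P y = ideal_class P (x \<oplus> y)"
  using ideal_class_rep[OF assms(1)] ideal_class_rep[OF assms(2)] assms
  by (simp add: ideal_quotient_def Let_def ideal_class_eq_iff le_mod_ideal_plus[OF P])

lemma ideal_quotient_neg:
  assumes "x \<in> carrier A"
  shows "\<sim>\<^bsub>ideal_quotient P\<^esub> (ideal_class P x) = ideal_class P (\<sim> x)"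
  using ideal_class_rep[OF assms(1)] assms
  by (simp add: ideal_quotient_def Let_def ideal_class_eq_iff neg_minus_neg)

lemma ideal_quotient_delta:
  assumes "x \<in> carrier A" "m \<ge> 1"
  shows "\<delta>\<^bsub>ideal_quotient P\<^esub> m (ideal_class P x) = ideal_class P (\<delta> m x)"
  using ideal_class_rep[OF assms(1)] assms
  by (simp add: ideal_quotient_def Let_def ideal_class_eq_iff le_mod_ideal_delta[OF P prime])

lemma ideal_quotient_mult:
  assumes "x \<in> carrier A"
  shows "mv_mult (ideal_quotient P) m (ideal_class P x) = ideal_class P (mv_mult A m x)"
  using assms by (induction m) (simp_all add: ideal_quotient_simps ideal_quotient_plus)

lemma ideal_quotient_hom: "ideal_class P \<in> dmv_hom A (ideal_quotient P)"
  by (auto simp: dmv_hom_def ideal_quotient_simps ideal_quotient_plus ideal_quotient_neg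
      ideal_quotient_delta)

lemma dmv_algebra_ideal_quotient: "dmv_algebra (ideal_quotient P)"
proof
  fix X Y assume "X \<in> carrier (ideal_quotient P)" "Y \<in> carrier (ideal_quotient P)"
  then show "\<sim>\<^bsub>ideal_quotient P\<^esub> (\<sim>\<^bsub>ideal_quotient P\<^esub> X \<oplus>\<^bsub>ideal_quotient P\<^esub> Y) \<oplus>\<^bsub>ideal_quotient P\<^esub> Y =
    \<sim>\<^bsub>ideal_quotient P\<^esub> (\<sim>\<^bsub>ideal_quotient P\<^esub> Y \<oplus>\<^bsub>ideal_quotient P\<^esub> X) \<oplus>\<^bsub>ideal_quotient P\<^esub> X"
    using lukasiewicz
    by (auto simp: ideal_quotient_simps ideal_quotient_plus ideal_quotient_neg)
next
  fix X Y assume "X \<in> carrier (ideal_quotient P)" "Y \<in> carrier (ideal_quotient P)"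
  then show "X \<oplus>\<^bsub>ideal_quotient P\<^esub> Y = Y \<oplus>\<^bsub>ideal_quotient P\<^esub> X"
    using plus_comm by (auto simp: ideal_quotient_simps ideal_quotient_plus)
qed (auto simp: ideal_quotient_simps ideal_quotient_plus ideal_quotient_neg ideal_quotient_delta
    ideal_quotient_mult mult_delta plus_assoc mv_odot_def delta_odot[unfolded mv_odot_def One_nat_def])

lemma dmv_chain_ideal_quotient: "dmv_chain (ideal_quotient P)"
proof -
  interpret Q: dmv_algebra "ideal_quotient P" by (rule dmv_algebra_ideal_quotient)
  have "Q.mv_le (ideal_class P x) (ideal_class P y)"
    if "x \<in> carrier A" "y \<in> carrier A" "x \<ominus> y \<in> P" for x y
  proof -
    have "\<one> \<ominus> (\<sim> x \<oplus> y) \<in> P" "(\<sim> x \<oplus> y) \<ominus> \<one> \<in> P"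
      using that mv_idealD(2)[OF P] by (simp_all add: mv_minus_def)
    then show ?thesis using that
      by (simp add: Q.mv_le_def ideal_quotient_simps ideal_quotient_plus ideal_quotient_neg
          ideal_class_eq_iff)
  qed
  then have "Q.mv_le X Y \<or> Q.mv_le Y X"
    if "X \<in> carrier (ideal_quotient P)" "Y \<in> carrier (ideal_quotient P)" for X Y
    using that prime unfolding ideal_quotient_simps by blast
  then show ?thesis by unfold_locales
qed

end

text \<open>The DMV-version of Chang's subdirect representation: the homomorphisms to chains separate
  each nonzero element from \<open>\<zero>\<close>.\<close>

theorem chain_separation:
  assumes "a \<in> carrier A" "a \<noteq> \<zero>"
  shows "\<exists>(Q :: 'a set dmv) h. dmv_chain Q \<and> h \<in> dmv_hom A Q \<and> h a \<noteq> \<zero>\<^bsub>Q\<^esub>"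
proof -
  obtain P where P: "mv_ideal P" "a \<notin> P"
    "\<And>x y. x \<in> carrier A \<Longrightarrow> y \<in> carrier A \<Longrightarrow> x \<ominus> y \<in> P \<or> y \<ominus> x \<in> P"
    using prime_ideal_exists assms by blast
  have "ideal_class P a \<noteq> ideal_class P \<zero>"
    using P assms by (simp add: ideal_class_eq_iff mv_minus_def)
  then show ?thesis
    using dmv_chain_ideal_quotient[OF P(1,3)] ideal_quotient_hom[OF P(1,3)]
      ideal_quotient_simps(2)[OF P(1,3)] by metis
qed

end

section \<open>Division in a chain\<close>

context dmv_chain
begin

lemma exact_part_le_chain:
  assumes "a \<in> carrier A" "b \<in> carrier A" "m \<ge> 1" "a \<sqsubseteq> \<sim> (mv_mult A (m - 1) a)"
    "mv_mult A m a \<sqsubseteq> mv_mult A m b"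
  shows "a \<sqsubseteq> b"
  using exact_part_le[of a b \<zero> \<zero> m] total[of a b] assms by auto

text \<open>In a chain the two axioms for \<open>\<delta> m x\<close> characterize it.\<close>

lemma delta_unique:
  assumes "z \<in> carrier A" "m \<ge> 1" "z \<sqsubseteq> \<sim> (mv_mult A (m - 1) z)"
  shows "\<delta> m (mv_mult A m z) = z"
proof -
  have *: "\<delta> m (mv_mult A m z) \<in> carrier A"
    "mv_mult A m (\<delta> m (mv_mult A m z)) = mv_mult A m z"
    "\<delta> m (mv_mult A m z) \<sqsubseteq> \<sim> (mv_mult A (m - 1) (\<delta> m (mv_mult A m z)))"
    using assms mult_delta[of m "mv_mult A m z"] delta_exact[of m "mv_mult A m z"] by simp_all
  show ?thesis
    using assms * exact_part_le_chain[of z "\<delta> m (mv_mult A m z)" m]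
      exact_part_le_chain[of "\<delta> m (mv_mult A m z)" z m] by (intro le_antisym) simp_all
qed

lemma delta_mono:
  assumes "x \<in> carrier A" "y \<in> carrier A" "m \<ge> 1" "x \<sqsubseteq> y" shows "\<delta> m x \<sqsubseteq> \<delta> m y"
  using assms mult_delta[of m x] mult_delta[of m y] delta_exact[of m x]
    exact_part_le_chain[of "\<delta> m x" "\<delta> m y" m] by simp

text \<open>The element \<open>\<delta> m \<one>\<close> plays the role of \<open>1/m\<close>.\<close>

lemma unit_orth:
  assumes "m \<ge> 1" "i + j \<le> m"
  shows "mv_mult A i (\<delta> m \<one>) \<sqsubseteq> \<sim> (mv_mult A j (\<delta> m \<one>))"
  using assms(2)
proof (induction i arbitrary: j)
  case 0
  then show ?case using assms by simp
next
  case (Suc i)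
  let ?w = "\<delta> m \<one>"
  have w: "?w \<in> carrier A" using assms by simp
  have "mv_mult A j ?w \<sqsubseteq> mv_mult A (m - 1) ?w" using Suc.prems w by (intro mult_mono2) auto
  moreover have "mv_mult A (m - 1) ?w \<sqsubseteq> \<sim> ?w"
    using delta_exact[of m \<one>] assms w orth_sym[of ?w "mv_mult A (m - 1) ?w"] by simp
  ultimately have "mv_mult A j ?w \<sqsubseteq> \<sim> ?w" 
    using le_trans[of "mv_mult A j ?w" "mv_mult A (m - 1) ?w" "\<sim> ?w"] w by simp
  moreover have "mv_mult A i ?w \<sqsubseteq> \<sim> (?w \<oplus> mv_mult A j ?w)"
    using Suc.IH[of "Suc j"] Suc.prems w by (simp add: plus_comm)
  ultimately show ?case
    using orth_assoc'[of "mv_mult A i ?w" ?w "mv_mult A j ?w"] w orth_sym[of ?w "mv_mult A j ?w"]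
    by simp
qed

text \<open>With \<open>delta_unique\<close>, this makes every element below \<open>1/m\<close> the \<open>m\<close>-th part of its \<open>m\<close>-fold sum.\<close>

lemma le_unit_exact:
  assumes "m \<ge> 1" "z \<in> carrier A" "z \<sqsubseteq> \<delta> m \<one>"
  shows "z \<sqsubseteq> \<sim> (mv_mult A (m - 1) z)"
proof -
  let ?w = "\<delta> m \<one>"
  have w: "?w \<in> carrier A" using assms by simp
  have "z \<sqsubseteq> \<sim> (mv_mult A (m - 1) ?w)"
    using le_trans[of z ?w] delta_exact[of m \<one>] assms w by simp
  moreover have "\<sim> (mv_mult A (m - 1) ?w) \<sqsubseteq> \<sim> (mv_mult A (m - 1) z)"
    using assms w by (simp add: neg_le_neg mult_mono)
  ultimately show ?thesis
    using le_trans[of z "\<sim> (mv_mult A (m - 1) ?w)"] assms w by simp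
qed

text \<open>In \<open>[0,1]\<close> this is \<open>x/m + (1 - x)/m = 1/m\<close>. If the left-hand side is at most \<open>\<delta> m \<one>\<close>, then it
  is an exact \<open>m\<close>-th part of \<open>\<one>\<close>. Otherwise the complement of \<open>\<delta> m x\<close> in \<open>\<delta> m \<one>\<close> is at most
  \<open>\<delta> m (\<sim> x)\<close>, but its \<open>m\<close>-fold sum is at least \<open>\<sim> x\<close>, so the two coincide.\<close>

lemma delta_neg:
  assumes "m \<ge> 1" "x \<in> carrier A"
  shows "\<delta> m x \<oplus> \<delta> m (\<sim> x) = \<delta> m \<one>"
proof -
  let ?w = "\<delta> m \<one>" and ?x = "\<delta> m x" and ?u = "\<delta> m (\<sim> x)"
  have c: "?w \<in> carrier A" "?x \<in> carrier A" "?u \<in> carrier A" using assms by simp_all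
  have xw: "?x \<sqsubseteq> ?w" using assms by (intro delta_mono) auto
  consider "?x \<oplus> ?u \<sqsubseteq> ?w" | "?w \<sqsubseteq> ?x \<oplus> ?u" using total c by blast
  then show ?thesis
  proof cases
    case 1
    have "mv_mult A m (?x \<oplus> ?u) = \<one>" using assms c by (simp add: mult_plus mult_delta)
    then show ?thesis
      using delta_unique[of "?x \<oplus> ?u" m] le_unit_exact[of m "?x \<oplus> ?u"] 1 c assms by simp
  next
    case 2
    let ?v = "?w \<ominus> ?x"
    have vx: "?v \<oplus> ?x = ?w" using c xw by (simp add: le_minus_plus)
    have vu: "?v \<sqsubseteq> ?u" using 2 c by (simp add: minus_le_iff)
    have "mv_mult A m ?v \<oplus> x = mv_mult A m (?v \<oplus> ?x)"
      using assms c by (simp add: mult_plus mult_delta)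
    then have "mv_mult A m ?v \<oplus> x = \<one>" using vx assms by (simp add: mult_delta)
    then have "\<sim> x \<sqsubseteq> mv_mult A m ?v" using assms c by (simp add: mv_le_def plus_comm)
    then have "?u \<sqsubseteq> ?v"
      using exact_part_le_chain[of ?u ?v m] delta_exact[of m "\<sim> x"] assms c
      by (simp add: mult_delta)
    then have "?u = ?v" using vu c by (intro le_antisym) auto
    then show ?thesis using vx c by (simp add: plus_comm)
  qed
qed

text \<open>Together with \<open>unit_orth\<close> this is what makes the chain behave like an ordered group after
  scaling: \<open>\<delta> m\<close> turns untruncated sums into sums of elements below \<open>1/m\<close>.\<close>

lemma delta_plus:
  assumes "m \<ge> 1" "x \<in> carrier A" "y \<in> carrier A" "x \<sqsubseteq> \<sim> y"
  shows "\<delta> m (x \<oplus> y) = \<delta> m x \<oplus> \<delta> m y"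
proof -
  have "\<delta> m y \<sqsubseteq> \<delta> m (\<sim> x)" using assms orth_sym[of x y] by (intro delta_mono) auto
  then have "\<delta> m x \<oplus> \<delta> m y \<sqsubseteq> \<delta> m x \<oplus> \<delta> m (\<sim> x)" using assms by (intro plus_mono) auto
  then have "\<delta> m x \<oplus> \<delta> m y \<sqsubseteq> \<delta> m \<one>" using assms by (simp add: delta_neg)
  then have "\<delta> m (mv_mult A m (\<delta> m x \<oplus> \<delta> m y)) = \<delta> m x \<oplus> \<delta> m y"
    using assms by (intro delta_unique le_unit_exact) auto
  then show ?thesis using assms by (simp add: mult_plus mult_delta)
qed

lemma delta_mult:
  assumes "n \<ge> 1" "m \<ge> 1" "x \<in> carrier A"
  shows "mv_mult A m (\<delta> n (\<delta> m x)) = \<delta> n x"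
proof -
  have d: "\<delta> m x \<in> carrier A" using assms by simp
  have "mv_mult A k (\<delta> n (\<delta> m x)) = \<delta> n (mv_mult A k (\<delta> m x))" if "k \<le> m" for k
    using that
  proof (induction k)
    case 0
    show ?case using delta_plus[of n \<zero> \<zero>] delta_unique[of \<zero> n] assms by simp
  next
    case (Suc k)
    have "mv_mult A k (\<delta> m x) \<sqsubseteq> mv_mult A (m - 1) (\<delta> m x)"
      using Suc.prems d by (intro mult_mono2) auto
    moreover have "mv_mult A (m - 1) (\<delta> m x) \<sqsubseteq> \<sim> (\<delta> m x)"
      using delta_exact[of m x] assms d orth_sym[of "\<delta> m x" "mv_mult A (m - 1) (\<delta> m x)"] by simp
    ultimately have "mv_mult A k (\<delta> m x) \<sqsubseteq> \<sim> (\<delta> m x)"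
      using le_trans[of "mv_mult A k (\<delta> m x)" "mv_mult A (m - 1) (\<delta> m x)" "\<sim> (\<delta> m x)"] d by simp
    then show ?case using Suc assms d by (simp add: delta_plus)
  qed
  then show ?thesis using assms by (simp add: mult_delta)
qed

lemma delta_zero: "m \<ge> 1 \<Longrightarrow> \<delta> m \<zero> = \<zero>"
  using delta_unique[of \<zero> m] by simp

end

section \<open>Fourier-Motzkin elimination for approximately additive signs\<close>

lemma finite_separation:
  fixes X Y :: "real set"
  assumes "finite X" "finite Y" "\<And>x y. x \<in> X \<Longrightarrow> y \<in> Y \<Longrightarrow> x < y"
  shows "\<exists>c. (\<forall>x\<in>X. x < c) \<and> (\<forall>y\<in>Y. c < y)"
proof (cases "X = {} \<or> Y = {}")
  case True
  obtain b where b: "\<And>x. x \<in> X \<Longrightarrow> \<bar>x\<bar> < b"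
    using finite_imp_bounded[OF assms(1)] unfolding bounded_pos_less by auto
  obtain b' where b': "\<And>y. y \<in> Y \<Longrightarrow> \<bar>y\<bar> < b'"
    using finite_imp_bounded[OF assms(2)] unfolding bounded_pos_less by auto
  have "\<forall>x\<in>X. x < b" "\<forall>y\<in>Y. - b' < y" using b b' by (force simp: abs_less_iff)+
  with True show ?thesis by blast
next
  case False
  then have "Max X < Min Y" using assms by (intro assms(3)) auto
  then obtain c where "Max X < c" "c < Min Y" using dense by blast
  then show ?thesis using assms(1,2) False by (intro exI[of _ c]) auto
qed

text \<open>Here \<open>L p\<close> makes \<open>r p\<close> a lower bound of the number sought, and \<open>H p\<close> makes it an upper bound. A bound
  of both kinds determines that number; otherwise all lower bounds are strictly below all upper
  bounds.\<close>

lemma cut_exists: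
  fixes r :: "'a \<Rightarrow> real"
  assumes fin: "finite F" and cover: "\<And>p. p \<in> F \<Longrightarrow> L p \<or> H p"
    and le: "\<And>p q. p \<in> F \<Longrightarrow> q \<in> F \<Longrightarrow> L p \<Longrightarrow> H q \<Longrightarrow> r p \<le> r q"
    and eq: "\<And>p q. p \<in> F \<Longrightarrow> q \<in> F \<Longrightarrow> L p \<Longrightarrow> H q \<Longrightarrow> r p = r q \<Longrightarrow> H p \<and> L q"
  shows "\<exists>c. \<forall>p\<in>F. (L p \<longleftrightarrow> r p \<le> c) \<and> (H p \<longleftrightarrow> c \<le> r p)"
proof (cases "\<exists>p\<in>F. L p \<and> H p")
  case True
  then obtain p where "p \<in> F" "L p" "H p" by blast
  have "(L q \<longleftrightarrow> r q \<le> r p) \<and> (H q \<longleftrightarrow> r p \<le> r q)" if "q \<in> F" for q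
    using that \<open>p \<in> F\<close> \<open>L p\<close> \<open>H p\<close> cover[of q] le[of p q] le[of q p] eq[of p q] eq[of q p] by linarith
  then show ?thesis by blast
next
  case False
  have "r p < r q" if "p \<in> F" "q \<in> F" "L p" "H q" for p q
    using le[OF that] eq[OF that] False that by (metis order_le_less)
  then have "\<exists>c. (\<forall>x\<in>r ` {p \<in> F. L p}. x < c) \<and> (\<forall>y\<in>r ` {p \<in> F. H p}. c < y)"
    using fin by (intro finite_separation) auto
  then obtain c where "\<And>p. p \<in> F \<Longrightarrow> L p \<Longrightarrow> r p < c" "\<And>p. p \<in> F \<Longrightarrow> H p \<Longrightarrow> c < r p" by auto
  note c = this
  have "(L q \<longleftrightarrow> r q \<le> c) \<and> (H q \<longleftrightarrow> c \<le> r q)" if "q \<in> F" for q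
    using that cover[of q] c[of q] by force
  then show ?thesis by blast
qed

text \<open>Think of \<open>pos N p\<close> as the statement that the integer linear form \<open>p\<close> is nonnegative at some
  point of an ordered group, where additivity is known only for \<open>N\<close> far along the filter. For a finite
  set of forms there is then a real point with the same signs, as soon as \<open>N\<close> is far enough: the
  variables are eliminated one at a time, and each elimination invokes additivity for finitely many
  pairs of forms that do not depend on \<open>N\<close>.\<close>

lemma sign_realization:
  fixes pos :: "'i \<Rightarrow> ('v \<Rightarrow> int) \<Rightarrow> bool"
  assumes tot: "\<And>N p. pos N p \<or> pos N (\<lambda>v. - p v)"
    and add: "\<And>p q. \<forall>\<^sub>F N in \<F>. pos N p \<longrightarrow> pos N q \<longrightarrow> pos N (\<lambda>v. p v + q v)"
    and "finite S" "finite F" "\<And>p v. p \<in> F \<Longrightarrow> v \<notin> S \<Longrightarrow> p v = 0"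
  shows "\<forall>\<^sub>F N in \<F>. \<exists>x::'v \<Rightarrow> real. \<forall>p\<in>F. pos N p \<longleftrightarrow> 0 \<le> (\<Sum>v\<in>S. p v * x v)"
  using assms(3-5)
proof (induction S arbitrary: F rule: finite_induct)
  case empty
  then have "p = (\<lambda>_. 0)" if "p \<in> F" for p using that by auto
  moreover have "pos N (\<lambda>_. 0)" for N using tot[of N "\<lambda>_. 0"] by simp
  ultimately show ?case by (intro always_eventually) auto
next
  case (insert j S)
  have mult: "\<forall>\<^sub>F N in \<F>. pos N p \<longrightarrow> pos N (\<lambda>v. int k * p v)" for k p
  proof (induction k)
    case 0
    show ?case using tot[of _ "\<lambda>_. 0"] by simp
  next
    case (Suc k)
    with add[of p "\<lambda>v. int k * p v"] show ?case
      by eventually_elim (auto simp: algebra_simps)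
  qed
  have comb: "\<forall>\<^sub>F N in \<F>. pos N p \<longrightarrow> pos N q \<longrightarrow> pos N (\<lambda>v. a * p v + b * q v)"
    if "a \<ge> 0" "b \<ge> 0" for a b p q
    using mult[of p "nat a"] mult[of q "nat b"] add[of "\<lambda>v. a * p v" "\<lambda>v. b * q v"]
    by eventually_elim (use that in auto)
  have scale: "\<forall>\<^sub>F N in \<F>. pos N (\<lambda>v. a * p v) \<longrightarrow> pos N p" if "a > 0" for a p
    using comb[of 1 "a - 1" "\<lambda>v. a * p v" "\<lambda>v. - p v"]
    by (rule eventually_mono) (use that tot[of _ p] in \<open>auto simp: algebra_simps\<close>)
  define neg :: "('v \<Rightarrow> int) \<Rightarrow> 'v \<Rightarrow> int" where "neg p = (\<lambda>v. - p v)" for p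
  \<comment> \<open>the combination of \<open>p\<close> and \<open>q\<close> in which the variable \<open>j\<close> cancels\<close>
  define elim :: "('v \<Rightarrow> int) \<Rightarrow> ('v \<Rightarrow> int) \<Rightarrow> 'v \<Rightarrow> int"
    where "elim p q = (\<lambda>v. q j * p v - p j * q v)" for p q
  \<comment> \<open>the forms that bound the variable \<open>j\<close>, with signs adjusted so that each \<open>p \<in> G\<close>
    bounds it from below and its negation bounds it from above\<close>
  define G where "G = {p \<in> F \<union> neg ` F. 0 < p j}"
  define F' where "F' = {p \<in> F. p j = 0} \<union> (\<lambda>(p, q). elim p q) ` (G \<times> G)"
  have finG: "finite G" using insert.prems by (simp add: G_def)
  have suppG: "p v = 0" if "p \<in> G" "v \<notin> insert j S" for p v
    using that insert.prems(2) by (auto simp: G_def neg_def)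
  have "\<forall>\<^sub>F N in \<F>. \<exists>x::'v \<Rightarrow> real. \<forall>p\<in>F'. pos N p \<longleftrightarrow> 0 \<le> (\<Sum>v\<in>S. p v * x v)"
  proof (rule insert.IH)
    show "finite F'" using finG insert.prems by (simp add: F'_def)
    fix p v assume "p \<in> F'" "v \<notin> S"
    then consider "p \<in> F" "p j = 0" | q q' where "q \<in> G" "q' \<in> G" "p = elim q q'"
      by (auto simp: F'_def)
    then show "p v = 0"
    proof cases
      case 1
      then show ?thesis using insert.prems(2)[of p v] \<open>v \<notin> S\<close> by (cases "v = j") auto
    next
      case 2
      then show ?thesis
        using suppG[of q v] suppG[of q' v] \<open>v \<notin> S\<close> by (cases "v = j") (auto simp: elim_def)
    qed
  qed
  moreover have "\<forall>\<^sub>F N in \<F>. \<forall>p\<in>G. \<forall>q\<in>G. pos N p \<longrightarrow> pos N (neg q) \<longrightarrow> pos N (elim p q)"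
  proof (intro eventually_ball_finite ballI finG)
    fix p q assume "p \<in> G" "q \<in> G"
    then show "\<forall>\<^sub>F N in \<F>. pos N p \<longrightarrow> pos N (neg q) \<longrightarrow> pos N (elim p q)"
      using comb[of "q j" "p j" p "neg q"] by (simp add: G_def elim_def neg_def)
  qed
  moreover have "\<forall>\<^sub>F N in \<F>. \<forall>p\<in>G. \<forall>q\<in>G. pos N (elim q p) \<longrightarrow> pos N p \<longrightarrow> pos N q"
  proof (intro eventually_ball_finite ballI finG)
    fix p q assume "p \<in> G" "q \<in> G"
    then have j: "0 < p j" "0 < q j" by (auto simp: G_def)
    have *: "(\<lambda>v. 1 * elim q p v + q j * p v) = (\<lambda>v. p j * q v)" by (simp add: elim_def)
    have "\<forall>\<^sub>F N in \<F>. pos N (elim q p) \<longrightarrow> pos N p \<longrightarrow> pos N (\<lambda>v. p j * q v)"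
      using comb[of 1 "q j" "elim q p" p] j unfolding * by simp
    with scale[OF j(1), of q] show "\<forall>\<^sub>F N in \<F>. pos N (elim q p) \<longrightarrow> pos N p \<longrightarrow> pos N q"
      by eventually_elim (use j in auto)
  qed
  moreover have "\<forall>\<^sub>F N in \<F>. \<forall>p\<in>G. \<forall>q\<in>G. pos N (elim q p) \<longrightarrow> pos N (neg q) \<longrightarrow> pos N (neg p)"
  proof (intro eventually_ball_finite ballI finG)
    fix p q assume "p \<in> G" "q \<in> G"
    then have j: "0 < p j" "0 < q j" by (auto simp: G_def)
    have *: "(\<lambda>v. 1 * elim q p v + p j * neg q v) = (\<lambda>v. q j * neg p v)" by (simp add: elim_def neg_def)
    have "\<forall>\<^sub>F N in \<F>. pos N (elim q p) \<longrightarrow> pos N (neg q) \<longrightarrow> pos N (\<lambda>v. q j * neg p v)"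
      using comb[of 1 "p j" "elim q p" "neg q"] j unfolding * by simp
    with scale[OF j(2), of "neg p"]
    show "\<forall>\<^sub>F N in \<F>. pos N (elim q p) \<longrightarrow> pos N (neg q) \<longrightarrow> pos N (neg p)"
      by eventually_elim (use j in auto)
  qed
  ultimately show ?case
  proof eventually_elim
    case (elim N)
    then obtain x :: "'v \<Rightarrow> real"
      where x: "\<And>p. p \<in> F' \<Longrightarrow> pos N p \<longleftrightarrow> 0 \<le> (\<Sum>v\<in>S. p v * x v)" by blast
    \<comment> \<open>the value of the variable \<open>j\<close> at which \<open>p\<close> vanishes\<close>
    define r where "r p = - (\<Sum>v\<in>S. p v * x v) / p j" for p
    have r: "pos N (elim p q) \<longleftrightarrow> r p \<le> r q" if "p \<in> G" "q \<in> G" for p q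
    proof -
      have j: "0 < p j" "0 < q j" using that by (auto simp: G_def)
      have "pos N (elim p q) \<longleftrightarrow> 0 \<le> (\<Sum>v\<in>S. elim p q v * x v)"
        using that by (intro x) (auto simp: F'_def)
      also have "(\<Sum>v\<in>S. elim p q v * x v) = q j * (\<Sum>v\<in>S. p v * x v) - p j * (\<Sum>v\<in>S. q v * x v)"
        by (simp add: elim_def left_diff_distrib sum_subtractf sum_distrib_left mult.assoc)
      also have "0 \<le> \<dots> \<longleftrightarrow> r p \<le> r q"
        using j by (simp add: r_def divide_simps mult.commute)
      finally show ?thesis .
    qed
    have "\<exists>c. \<forall>p\<in>G. (pos N p \<longleftrightarrow> r p \<le> c) \<and> (pos N (neg p) \<longleftrightarrow> c \<le> r p)"
    proof (rule cut_exists[OF finG])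
      show "pos N p \<or> pos N (neg p)" for p using tot by (simp add: neg_def)
      show "r p \<le> r q" if "p \<in> G" "q \<in> G" "pos N p" "pos N (neg q)" for p q
        using elim(2) that r by blast
      show "pos N (neg p) \<and> pos N q" if "p \<in> G" "q \<in> G" "pos N p" "pos N (neg q)" "r p = r q" for p q
        using elim(3,4) that r[of q p] by auto
    qed
    then obtain c where c: "\<And>p. p \<in> G \<Longrightarrow> pos N p \<longleftrightarrow> r p \<le> c"
      "\<And>p. p \<in> G \<Longrightarrow> pos N (neg p) \<longleftrightarrow> c \<le> r p" by blast
    have "pos N p \<longleftrightarrow> 0 \<le> (\<Sum>v\<in>insert j S. p v * (x(j := c)) v)" if "p \<in> F" for p
    proof -
      have *: "(\<Sum>v\<in>insert j S. p v * (x(j := c)) v) = p j * c + (\<Sum>v\<in>S. p v * x v)"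
        using insert.hyps by (auto intro!: sum.cong)
      consider "p j = 0" | "p j > 0" | "p j < 0" by linarith
      then show ?thesis
      proof cases
        case 1
        then show ?thesis using x[of p] that unfolding * by (simp add: F'_def)
      next
        case 2
        then have "p \<in> G" using that by (simp add: G_def)
        then have "pos N p \<longleftrightarrow> r p \<le> c" by (rule c)
        also have "\<dots> \<longleftrightarrow> 0 \<le> p j * c + (\<Sum>v\<in>S. p v * x v)"
          unfolding r_def pos_divide_le_eq[OF 2[folded of_int_0_less_iff[where 'a=real]]]
          by (simp add: mult.commute) linarith
        finally show ?thesis unfolding * .
      next
        case 3
        then have "neg p \<in> G" using that by (simp add: G_def neg_def)
        moreover have "neg (neg p) = p" by (simp add: neg_def)
        ultimately show ?thesis using c(2)[of "neg p"] 3 unfolding *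
          by (simp add: r_def neg_def field_simps sum_negf) linarith
      qed
    qed
    then show ?case by blast
  qed
qed

section \<open>Finite parts of a chain embed into the unit interval\<close>

lemma sum_count_list:
  fixes \<xi> :: "'v \<Rightarrow> real"
  assumes "finite S" "set L \<subseteq> S"
  shows "(\<Sum>v\<in>S. real (count_list L v) * \<xi> v) = (\<Sum>v\<leftarrow>L. \<xi> v)"
  using assms(2)
proof (induction L)
  case (Cons u L)
  have "(\<Sum>v\<in>S. real (count_list (u # L) v) * \<xi> v) =
      (\<Sum>v\<in>S. (if v = u then \<xi> v else 0) + real (count_list L v) * \<xi> v)"
    by (intro sum.cong) (auto simp: algebra_simps)
  then show ?case using Cons assms(1) by (simp add: sum.distrib)
qed simp

context mv_algebra
begin

primrec lsum :: "'a list \<Rightarrow> 'a" where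
  "lsum [] = \<zero>"
| "lsum (x # xs) = x \<oplus> lsum xs"

text \<open>The value of the formal sum with multiplicities \<open>a\<close>; the list \<open>vs\<close> enumerates the variables.\<close>

primrec wsum :: "('v \<Rightarrow> 'a) \<Rightarrow> 'v list \<Rightarrow> ('v \<Rightarrow> nat) \<Rightarrow> 'a" where
  "wsum e [] a = \<zero>"
| "wsum e (v # vs) a = mv_mult A (a v) (e v) \<oplus> wsum e vs a"

lemma lsum_closed [simp]: "set xs \<subseteq> carrier A \<Longrightarrow> lsum xs \<in> carrier A"
  by (induction xs) auto

lemma lsum_replicate: "x \<in> carrier A \<Longrightarrow> lsum (replicate m x) = mv_mult A m x"
  by (induction m) (auto simp: plus_comm)

lemma wsum_closed [simp]: "e ` set vs \<subseteq> carrier A \<Longrightarrow> wsum e vs a \<in> carrier A"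
  by (induction vs) auto

lemma wsum_add:
  "e ` set vs \<subseteq> carrier A \<Longrightarrow> wsum e vs (\<lambda>v. a v + b v) = wsum e vs a \<oplus> wsum e vs b"
  by (induction vs) (auto simp: mult_add plus_ac)

lemma wsum_cong: "(\<And>v. v \<in> set vs \<Longrightarrow> a v = b v) \<Longrightarrow> wsum e vs a = wsum e vs b"
  by (induction vs) auto

lemma wsum_zero: "e ` set vs \<subseteq> carrier A \<Longrightarrow> wsum e vs (\<lambda>v. 0) = \<zero>"
  by (induction vs) auto

lemma wsum_single:
  assumes "e ` set vs \<subseteq> carrier A" "distinct vs" "u \<in> set vs"
  shows "wsum e vs (\<lambda>v. if v = u then 1 else 0) = e u"
  using assms
proof (induction vs)
  case (Cons v vs)
  show ?case
  proof (cases "v = u")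
    case True
    have "wsum e vs (\<lambda>v. if v = u then 1 else 0) = wsum e vs (\<lambda>v. 0)"
      using Cons.prems True by (intro wsum_cong) auto
    then show ?thesis using Cons.prems True by (simp add: wsum_zero)
  next
    case False
    then show ?thesis using Cons by auto
  qed
qed simp

lemma wsum_count_list:
  assumes "e ` set vs \<subseteq> carrier A" "distinct vs" "set L \<subseteq> set vs"
  shows "wsum e vs (count_list L) = lsum (map e L)"
  using assms(3)
proof (induction L)
  case Nil
  have "count_list ([] :: 'b list) = (\<lambda>v. 0)" by auto
  then show ?case using wsum_zero[OF assms(1)] by simp
next
  case (Cons u L)
  have "count_list (u # L) = (\<lambda>v. (if v = u then 1 else 0) + count_list L v)" by auto
  then show ?case using Cons wsum_add[OF assms(1)] wsum_single[OF assms(1,2)] by simp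
qed

lemma wsum_bound:
  assumes "e ` set vs \<subseteq> carrier A" "w \<in> carrier A" "\<And>v. v \<in> set vs \<Longrightarrow> e v \<sqsubseteq> w"
  shows "wsum e vs a \<sqsubseteq> mv_mult A (\<Sum>v\<leftarrow>vs. a v) w"
  using assms
  by (induction vs) (auto simp: mult_add intro!: plus_mono mult_mono)

end

context dmv_chain
begin

lemma delta_sum_orth:
  assumes "m \<ge> 1" "set vs \<subseteq> carrier A" "(\<Sum>v\<leftarrow>vs. a v) + (\<Sum>v\<leftarrow>vs. b v) \<le> m"
  shows "wsum (\<delta> m) vs a \<sqsubseteq> \<sim> (wsum (\<delta> m) vs b)"
proof -
  let ?w = "\<lambda>k. mv_mult A k (\<delta> m \<one>)"
  have im: "\<delta> m ` set vs \<subseteq> carrier A" using assms by auto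
  have bd: "wsum (\<delta> m) vs a \<sqsubseteq> ?w (\<Sum>v\<leftarrow>vs. a v)" for a
    using assms by (intro wsum_bound) (auto intro!: delta_mono)
  have c: "wsum (\<delta> m) vs a \<in> carrier A" for a using im by simp
  have w: "?w k \<in> carrier A" for k using assms by simp
  show ?thesis
    using le_trans[OF c w _ bd[of a] unit_orth[OF assms(1,3)]]
      le_trans[of "wsum (\<delta> m) vs a" "\<sim> (?w (\<Sum>v\<leftarrow>vs. b v))" "\<sim> (wsum (\<delta> m) vs b)"] bd[of b]
      c w neg_le_neg by simp
qed

text \<open>The sign of the formal sum \<open>p\<close> as the chain sees it when every element is divided by \<open>m\<close>:
  compare the negative part with the positive part.\<close>

definition delta_sign :: "nat \<Rightarrow> 'a list \<Rightarrow> ('a \<Rightarrow> int) \<Rightarrow> bool" where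
  "delta_sign m vs p \<longleftrightarrow> wsum (\<delta> m) vs (\<lambda>v. nat (- p v)) \<sqsubseteq> wsum (\<delta> m) vs (\<lambda>v. nat (p v))"

text \<open>Any representation of \<open>p\<close> as a difference gives the same sign, provided that \<open>m\<close> is large enough
  for all the sums involved to be untruncated, so that they can be cancelled.\<close>

lemma delta_sign_iff:
  assumes m: "m \<ge> 1" and vs: "set vs \<subseteq> carrier A"
    and p: "\<And>v. p v = int (b v) - int (a v)"
    and bound: "(\<Sum>v\<leftarrow>vs. a v) + (\<Sum>v\<leftarrow>vs. b v) + (\<Sum>v\<leftarrow>vs. nat (p v)) + (\<Sum>v\<leftarrow>vs. nat (- p v)) \<le> m"
  shows "delta_sign m vs p \<longleftrightarrow> wsum (\<delta> m) vs a \<sqsubseteq> wsum (\<delta> m) vs b"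
proof -
  let ?s = "wsum (\<delta> m) vs" and ?p = "\<lambda>v. nat (p v)" and ?n = "\<lambda>v. nat (- p v)"
  have im: "\<delta> m ` set vs \<subseteq> carrier A" using vs m by auto
  have c: "?s f \<in> carrier A" for f using im by simp
  have "(\<lambda>v. b v + ?n v) = (\<lambda>v. a v + ?p v)" using p by (auto simp: fun_eq_iff)
  then have eq: "?s b \<oplus> ?s ?n = ?s a \<oplus> ?s ?p" using wsum_add[OF im] by metis
  have o1: "?s a \<sqsubseteq> \<sim> (?s ?p)" using m vs bound by (intro delta_sum_orth) auto
  have o2: "?s ?n \<sqsubseteq> \<sim> (?s b)" using m vs bound by (intro delta_sum_orth) auto
  show ?thesis
  proof
    assume "delta_sign m vs p"
    then have "?s b \<oplus> ?s ?n \<sqsubseteq> ?s b \<oplus> ?s ?p"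
      using c by (intro plus_mono) (auto simp: delta_sign_def)
    then show "?s a \<sqsubseteq> ?s b" using plus_le_cancel[OF c c c o1] eq by simp
  next
    assume "?s a \<sqsubseteq> ?s b"
    then have "?s a \<oplus> ?s ?p \<sqsubseteq> ?s b \<oplus> ?s ?p" using c by (intro plus_mono) auto
    then have "?s ?n \<oplus> ?s b \<sqsubseteq> ?s ?p \<oplus> ?s b" using eq c by (simp add: plus_comm)
    then show "delta_sign m vs p" using plus_le_cancel[OF c c c o2] by (simp add: delta_sign_def)
  qed
qed

text \<open>The comparison of two sums is the sign of the difference of their counting functions, and the lists
  of length at most \<open>n\<close> over \<open>S\<close> give finitely many such differences, so \<open>sign_realization\<close> applies.\<close>

lemma delta_sum_embedding:
  assumes S: "finite S" "S \<subseteq> carrier A"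
  shows "\<exists>m\<ge>1. \<exists>\<xi>::'a \<Rightarrow> real. \<forall>K L. set K \<subseteq> S \<longrightarrow> set L \<subseteq> S \<longrightarrow> length K \<le> n \<longrightarrow> length L \<le> n \<longrightarrow>
    (lsum (map (\<delta> m) K) \<sqsubseteq> lsum (map (\<delta> m) L) \<longleftrightarrow> (\<Sum>v\<leftarrow>K. \<xi> v) \<le> (\<Sum>v\<leftarrow>L. \<xi> v))"
proof -
  obtain vs where vs: "set vs = S" "distinct vs" using finite_distinct_list[OF S(1)] by blast
  define LL where "LL = {K. set K \<subseteq> S \<and> length K \<le> n}"
  have LL: "finite LL" using finite_lists_length_le[OF S(1)] by (simp add: LL_def)
  define form :: "'a list \<Rightarrow> 'a list \<Rightarrow> 'a \<Rightarrow> int"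
    where "form K L = (\<lambda>v. int (count_list L v) - int (count_list K v))" for K L
  define F where "F = (\<lambda>(K, L). form K L) ` (LL \<times> LL)"
  have vsc: "set vs \<subseteq> carrier A" using vs S by simp
  have count0: "count_list K v = 0" if "set K \<subseteq> S" "v \<notin> S" for K v
    using that by (intro count_notin) auto
  \<comment> \<open>\<open>Suc m\<close> is used since the operation with index \<open>0\<close> is arbitrary\<close>
  have "\<forall>\<^sub>F m in sequentially. \<exists>\<xi>::'a \<Rightarrow> real. \<forall>p\<in>F.
      delta_sign (Suc m) vs p \<longleftrightarrow> 0 \<le> (\<Sum>v\<in>S. p v * \<xi> v)"
  proof (rule sign_realization)
    have c: "wsum (\<delta> (Suc m)) vs a \<in> carrier A" for m a using vsc by (intro wsum_closed) auto
    show "delta_sign (Suc m) vs p \<or> delta_sign (Suc m) vs (\<lambda>v. - p v)" for m p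
      using total[OF c c] by (simp add: delta_sign_def)
    show "\<forall>\<^sub>F m in sequentially. delta_sign (Suc m) vs p \<longrightarrow> delta_sign (Suc m) vs q \<longrightarrow>
        delta_sign (Suc m) vs (\<lambda>v. p v + q v)" for p q
    proof (rule eventually_sequentiallyI, intro impI)
      let ?a = "\<lambda>v. nat (- p v) + nat (- q v)" and ?b = "\<lambda>v. nat (p v) + nat (q v)"
      let ?r = "\<lambda>v. p v + q v"
      fix m
      assume m: "(\<Sum>v\<leftarrow>vs. ?a v) + (\<Sum>v\<leftarrow>vs. ?b v) +
          (\<Sum>v\<leftarrow>vs. nat (?r v)) + (\<Sum>v\<leftarrow>vs. nat (- ?r v)) \<le> m"
        and "delta_sign (Suc m) vs p" "delta_sign (Suc m) vs q"
      then have "wsum (\<delta> (Suc m)) vs ?a \<sqsubseteq> wsum (\<delta> (Suc m)) vs ?b"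
        using c vsc by (subst (1 2) wsum_add) (auto simp: delta_sign_def intro!: plus_mono)
      then show "delta_sign (Suc m) vs ?r"
        using m vsc by (subst delta_sign_iff[where a = ?a and b = ?b]) auto
    qed
    show "finite F" using LL by (simp add: F_def)
    show "p v = 0" if "p \<in> F" "v \<notin> S" for p v
      using that count0 by (auto simp: F_def form_def LL_def)
  qed (rule S)
  moreover have "\<forall>\<^sub>F m in sequentially. \<forall>K\<in>LL. \<forall>L\<in>LL.
      delta_sign (Suc m) vs (form K L) \<longleftrightarrow>
      lsum (map (\<delta> (Suc m)) K) \<sqsubseteq> lsum (map (\<delta> (Suc m)) L)"
  proof (intro eventually_ball_finite[OF LL] ballI eventually_sequentiallyI)
    fix K L m
    assume KL: "K \<in> LL" "L \<in> LL"
      and m: "(\<Sum>v\<leftarrow>vs. count_list K v) + (\<Sum>v\<leftarrow>vs. count_list L v) +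
          (\<Sum>v\<leftarrow>vs. nat (form K L v)) + (\<Sum>v\<leftarrow>vs. nat (- form K L v)) \<le> m"
    have im: "\<delta> (Suc m) ` set vs \<subseteq> carrier A" using vsc by auto
    have "delta_sign (Suc m) vs (form K L) \<longleftrightarrow>
        wsum (\<delta> (Suc m)) vs (count_list K) \<sqsubseteq> wsum (\<delta> (Suc m)) vs (count_list L)"
      using m vsc by (intro delta_sign_iff) (auto simp: form_def)
    then show "delta_sign (Suc m) vs (form K L) \<longleftrightarrow>
        lsum (map (\<delta> (Suc m)) K) \<sqsubseteq> lsum (map (\<delta> (Suc m)) L)"
      using KL vs by (simp add: wsum_count_list[OF im] LL_def)
  qed
  ultimately have "\<forall>\<^sub>F m in sequentially. \<exists>\<xi>::'a \<Rightarrow> real. \<forall>K\<in>LL. \<forall>L\<in>LL.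
      lsum (map (\<delta> (Suc m)) K) \<sqsubseteq> lsum (map (\<delta> (Suc m)) L) \<longleftrightarrow> (\<Sum>v\<leftarrow>K. \<xi> v) \<le> (\<Sum>v\<leftarrow>L. \<xi> v)"
  proof eventually_elim
    case (elim m)
    then obtain \<xi> :: "'a \<Rightarrow> real" where \<xi>:
      "\<And>p. p \<in> F \<Longrightarrow> delta_sign (Suc m) vs p \<longleftrightarrow> 0 \<le> (\<Sum>v\<in>S. p v * \<xi> v)" by blast
    have "lsum (map (\<delta> (Suc m)) K) \<sqsubseteq> lsum (map (\<delta> (Suc m)) L) \<longleftrightarrow> (\<Sum>v\<leftarrow>K. \<xi> v) \<le> (\<Sum>v\<leftarrow>L. \<xi> v)"
      if KL: "K \<in> LL" "L \<in> LL" for K L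
    proof -
      have "(\<Sum>v\<in>S. form K L v * \<xi> v) = (\<Sum>v\<leftarrow>L. \<xi> v) - (\<Sum>v\<leftarrow>K. \<xi> v)"
        using KL sum_count_list[OF S(1), of _ \<xi>]
        by (simp add: form_def left_diff_distrib sum_subtractf LL_def)
      moreover have "form K L \<in> F" using KL by (auto simp: F_def)
      ultimately show ?thesis using \<xi>[of "form K L"] elim(2)[rule_format, OF KL] by simp
    qed
    then show ?case by blast
  qed
  then obtain m where "\<exists>\<xi>::'a \<Rightarrow> real. \<forall>K\<in>LL. \<forall>L\<in>LL.
      lsum (map (\<delta> (Suc m)) K) \<sqsubseteq> lsum (map (\<delta> (Suc m)) L) \<longleftrightarrow> (\<Sum>v\<leftarrow>K. \<xi> v) \<le> (\<Sum>v\<leftarrow>L. \<xi> v)"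
    using eventually_happens'[OF sequentially_bot] by blast
  then show ?thesis unfolding LL_def by (intro exI[of _ "Suc m"]) auto
qed

text \<open>Normalizing the real numbers of \<open>delta_sum_embedding\<close> so that \<open>\<one>\<close> becomes \<open>1\<close>, every operation
  is determined by comparisons of short sums: two summands suffice for \<open>\<sim>\<close> and \<open>\<oplus>\<close>, and \<open>k\<close> summands
  for \<open>\<delta> k\<close>. This is why \<open>k\<close> has to be bounded.\<close>

theorem chain_local_embedding:
  assumes S: "finite S" "S \<subseteq> carrier A" and nontriv: "\<zero> \<noteq> \<one>"
  obtains \<phi> :: "'a \<Rightarrow> real"
  where "\<phi> \<zero> = 0" "\<phi> \<one> = 1" "\<And>x. x \<in> S \<Longrightarrow> 0 \<le> \<phi> x" "\<And>x. x \<in> S \<Longrightarrow> \<phi> x \<le> 1"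
    "\<And>x. x \<in> S \<Longrightarrow> \<phi> x = 0 \<Longrightarrow> x = \<zero>"
    "\<And>x. x \<in> S \<Longrightarrow> \<sim> x \<in> S \<Longrightarrow> \<phi> (\<sim> x) = 1 - \<phi> x"
    "\<And>x y. x \<in> S \<Longrightarrow> y \<in> S \<Longrightarrow> x \<oplus> y \<in> S \<Longrightarrow> \<phi> (x \<oplus> y) = min 1 (\<phi> x + \<phi> y)"
    "\<And>x k. x \<in> S \<Longrightarrow> 1 \<le> k \<Longrightarrow> k \<le> n \<Longrightarrow> \<delta> k x \<in> S \<Longrightarrow> \<phi> (\<delta> k x) = \<phi> x / real k"
proof -
  define T where "T = insert \<zero> (insert \<one> S)"
  have "finite T" "T \<subseteq> carrier A" using S by (auto simp: T_def)
  then obtain m \<xi> where m: "m \<ge> 1" and emb: "\<And>K L. set K \<subseteq> T \<Longrightarrow> set L \<subseteq> T \<Longrightarrow>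
      length K \<le> max 2 n \<Longrightarrow> length L \<le> max 2 n \<Longrightarrow>
      lsum (map (\<delta> m) K) \<sqsubseteq> lsum (map (\<delta> m) L) \<longleftrightarrow> (\<Sum>v\<leftarrow>K. \<xi> v :: real) \<le> (\<Sum>v\<leftarrow>L. \<xi> v)"
    using delta_sum_embedding[of T "max 2 n"] by blast
  have dc: "\<delta> m x \<in> carrier A" if "x \<in> T" for x using that \<open>T \<subseteq> carrier A\<close> m by auto
  have T01: "\<zero> \<in> T" "\<one> \<in> T" "\<And>x. x \<in> S \<Longrightarrow> x \<in> T" by (auto simp: T_def)
  have emb_eq: "(\<Sum>v\<leftarrow>K. \<xi> v) = (\<Sum>v\<leftarrow>L. \<xi> v)"
    if "set K \<subseteq> T" "set L \<subseteq> T" "length K \<le> max 2 n" "length L \<le> max 2 n"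
      "lsum (map (\<delta> m) K) = lsum (map (\<delta> m) L)" for K L
  proof -
    have "lsum (map (\<delta> m) K) \<in> carrier A" using that dc by (intro lsum_closed) auto
    then have "lsum (map (\<delta> m) K) \<sqsubseteq> lsum (map (\<delta> m) L)" "lsum (map (\<delta> m) L) \<sqsubseteq> lsum (map (\<delta> m) K)"
      using that(5) by simp_all
    then show ?thesis using emb[of K L] emb[of L K] that by simp
  qed
  have \<xi>0: "\<xi> \<zero> = 0" using emb_eq[of "[\<zero>]" "[]"] T01 m by (simp add: delta_zero)
  have nonneg: "0 \<le> \<xi> x" if "x \<in> T" for x
    using emb[of "[]" "[x]"] that dc[OF that] by simp
  have pos: "\<xi> x = 0 \<longleftrightarrow> x = \<zero>" if "x \<in> T" for x
  proof
    assume "\<xi> x = 0"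
    then have "\<delta> m x = \<zero>" using emb[of "[x]" "[]"] that dc[OF that] by simp
    then show "x = \<zero>" using mult_delta[of m x] m that \<open>T \<subseteq> carrier A\<close> by auto
  qed (simp add: \<xi>0)
  have \<xi>1: "\<xi> \<one> > 0" using nonneg[of \<one>] pos[of \<one>] T01 nontriv by (simp add: less_le)
  have le1: "\<xi> x \<le> \<xi> \<one>" if "x \<in> T" for x
  proof -
    have "\<delta> m x \<sqsubseteq> \<delta> m \<one>" using that m \<open>T \<subseteq> carrier A\<close> by (intro delta_mono) auto
    then show ?thesis using emb[of "[x]" "[\<one>]"] that dc T01 by simp
  qed
  have neg: "\<xi> x + \<xi> (\<sim> x) = \<xi> \<one>" if "x \<in> T" "\<sim> x \<in> T" for x
  proof -
    have "x \<in> carrier A" using that \<open>T \<subseteq> carrier A\<close> by auto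
    then show ?thesis
      using emb_eq[of "[x, \<sim> x]" "[\<one>]"] that dc T01 m delta_neg[of m x] by simp
  qed
  have plus: "\<xi> (x \<oplus> y) = min (\<xi> \<one>) (\<xi> x + \<xi> y)" if xy: "x \<in> T" "y \<in> T" "x \<oplus> y \<in> T" for x y
  proof -
    have c: "x \<in> carrier A" "y \<in> carrier A" using that \<open>T \<subseteq> carrier A\<close> by auto
    consider "x \<sqsubseteq> \<sim> y" | "\<sim> y \<sqsubseteq> x" using c total[of x "\<sim> y"] by auto
    then show ?thesis
    proof cases
      case 1
      then have "\<xi> (x \<oplus> y) = \<xi> x + \<xi> y"
        using emb_eq[of "[x \<oplus> y]" "[x, y]"] c xy dc m by (simp add: delta_plus)
      then show ?thesis using le1[OF xy(3)] by simp
    next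
      case 2
      then have one: "x \<oplus> y = \<one>" using c by (simp add: mv_le_def plus_comm)
      have "\<delta> m (\<sim> y) \<oplus> \<delta> m y \<sqsubseteq> \<delta> m x \<oplus> \<delta> m y"
        using 2 c m by (intro plus_mono delta_mono) auto
      then have "\<delta> m \<one> \<sqsubseteq> \<delta> m x \<oplus> \<delta> m y" using c m delta_neg[of m y] by (simp add: plus_comm)
      then have "\<xi> \<one> \<le> \<xi> x + \<xi> y" using emb[of "[\<one>]" "[x, y]"] c xy dc T01 by simp
      then show ?thesis using one by simp
    qed
  qed
  have delta: "real k * \<xi> (\<delta> k x) = \<xi> x" if x: "x \<in> T" "\<delta> k x \<in> T" and k: "1 \<le> k" "k \<le> n" for x k
  proof -
    have "x \<in> carrier A" using that \<open>T \<subseteq> carrier A\<close> by auto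
    then have "lsum (map (\<delta> m) (replicate k (\<delta> k x))) = lsum (map (\<delta> m) [x])"
      using k m by (simp add: lsum_replicate delta_mult)
    then show ?thesis using emb_eq[of "replicate k (\<delta> k x)" "[x]"] that
      by (simp add: sum_list_replicate)
  qed
  define \<phi> where "\<phi> x = \<xi> x / \<xi> \<one>" for x
  show thesis
  proof (rule that)
    show "\<phi> \<zero> = 0" "\<phi> \<one> = 1" using \<xi>0 \<xi>1 by (auto simp: \<phi>_def)
    show "0 \<le> \<phi> x" "\<phi> x \<le> 1" if "x \<in> S" for x
      using \<xi>1 nonneg[of x] le1[of x] T01 that by (auto simp: \<phi>_def)
    show "x = \<zero>" if "x \<in> S" "\<phi> x = 0" for x
      using \<xi>1 pos[of x] T01 that by (simp add: \<phi>_def)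
    show "\<phi> (\<sim> x) = 1 - \<phi> x" if "x \<in> S" "\<sim> x \<in> S" for x
      using neg[of x] \<xi>1 T01 that by (simp add: \<phi>_def field_simps)
    show "\<phi> (x \<oplus> y) = min 1 (\<phi> x + \<phi> y)" if "x \<in> S" "y \<in> S" "x \<oplus> y \<in> S" for x y
      using plus[of x y] \<xi>1 T01 that by (simp add: \<phi>_def min_def field_simps)
    show "\<phi> (\<delta> k x) = \<phi> x / real k" if "x \<in> S" "1 \<le> k" "k \<le> n" "\<delta> k x \<in> S" for x k
      using delta[of x k] \<xi>1 T01 that by (simp add: \<phi>_def field_simps)
  qed
qed

end

section \<open>Completeness of the DMV-axioms for the unit interval\<close>

definition unit_dmv :: "real dmv" where
  "unit_dmv = \<lparr>carrier = {0..1}, mv_plus = (\<lambda>x y. min 1 (x + y)), mv_neg = (\<lambda>x. 1 - x),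
     mv_zero = 0, mv_one = 1, dmv_delta = (\<lambda>m x. x / real m)\<rparr>"

lemma unit_dmv_simps [simp]:
  "carrier unit_dmv = {0..1}" "x \<oplus>\<^bsub>unit_dmv\<^esub> y = min 1 (x + y)" "\<sim>\<^bsub>unit_dmv\<^esub> x = 1 - x"
  "\<zero>\<^bsub>unit_dmv\<^esub> = 0" "\<one>\<^bsub>unit_dmv\<^esub> = 1" "\<delta>\<^bsub>unit_dmv\<^esub> m x = x / real m"
  by (simp_all add: unit_dmv_def)

lemma mv_mult_unit_dmv: "0 \<le> x \<Longrightarrow> mv_mult unit_dmv m x = min 1 (real m * x)"
  by (induction m) (auto simp: min_def algebra_simps)

lemma dmv_algebra_unit_dmv: "dmv_algebra unit_dmv"
proof
  fix m :: nat and x :: real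
  assume m: "m \<ge> 1" and x: "x \<in> carrier unit_dmv"
  have "real (m - 1) * (x / real m) = x - x / real m" using m by (simp add: of_nat_diff field_simps)
  moreover have "0 \<le> x / real m" "0 \<le> x" "x \<le> 1" using x by auto
  ultimately show "\<delta>\<^bsub>unit_dmv\<^esub> m x \<odot>\<^bsub>unit_dmv\<^esub> mv_mult unit_dmv (m - 1) (\<delta>\<^bsub>unit_dmv\<^esub> m x) = \<zero>\<^bsub>unit_dmv\<^esub>"
    by (simp add: mv_mult_unit_dmv mv_odot_def del: One_nat_def)
qed (auto simp: mv_mult_unit_dmv min_def field_simps)

lemma term_val_hom:
  assumes "dmv_algebra A" "range g \<subseteq> carrier A" "h \<in> dmv_hom A B"
  shows "h (term_val A g s) = term_val B (h \<circ> g) s"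
proof -
  interpret dmv_algebra A by fact
  have "h (\<delta>\<^bsub>A\<^esub> (Suc k) x) = \<delta>\<^bsub>B\<^esub> (Suc k) (h x)" if "x \<in> carrier A" for k x
    using assms(3) that unfolding dmv_hom_def by auto
  then show ?thesis
    using assms(3) by (induction s) (auto simp: dmv_hom_def term_val_closed[OF assms(2)])
qed

primrec subterms :: "'v dmv_term \<Rightarrow> 'v dmv_term set" where
  "subterms (TVar v) = {TVar v}"
| "subterms TZero = {TZero}"
| "subterms TOne = {TOne}"
| "subterms (TNeg s) = insert (TNeg s) (subterms s)"
| "subterms (TPlus s t) = insert (TPlus s t) (subterms s \<union> subterms t)"
| "subterms (TDelta k s) = insert (TDelta k s) (subterms s)"

primrec delta_bound :: "'v dmv_term \<Rightarrow> nat" where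
  "delta_bound (TVar v) = 0"
| "delta_bound TZero = 0"
| "delta_bound TOne = 0"
| "delta_bound (TNeg s) = delta_bound s"
| "delta_bound (TPlus s t) = max (delta_bound s) (delta_bound t)"
| "delta_bound (TDelta k s) = max (Suc k) (delta_bound s)"

lemma finite_subterms: "finite (subterms s)"
  by (induction s) auto

lemma subterms_self: "s \<in> subterms s"
  by (cases s) auto

text \<open>Pass to a chain in which the value stays nonzero, and embed the finitely many values of the
  subterms into \<open>[0,1]\<close>.\<close>

lemma term_nonzero_real:
  assumes A: "dmv_algebra A" and g: "range g \<subseteq> carrier A" and t: "term_val A g t \<noteq> \<zero>\<^bsub>A\<^esub>"
  shows "\<exists>r. range r \<subseteq> {0..1} \<and> term_val unit_dmv r t \<noteq> 0"
proof -
  interpret A: dmv_algebra A by fact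
  obtain Q :: "'a set dmv" and h where Q: "dmv_chain Q" and h: "h \<in> dmv_hom A Q"
    and ht: "h (term_val A g t) \<noteq> \<zero>\<^bsub>Q\<^esub>"
    using A.chain_separation[OF A.term_val_closed[OF g] t] by blast
  interpret Q: dmv_chain Q by fact
  define g' where "g' = h \<circ> g"
  have g': "range g' \<subseteq> carrier Q" using h g unfolding g'_def dmv_hom_def by fastforce
  have t': "term_val Q g' t \<noteq> \<zero>\<^bsub>Q\<^esub>" using ht term_val_hom[OF A g h] by (simp add: g'_def)
  note c = Q.term_val_closed[OF g']
  have nontriv: "\<zero>\<^bsub>Q\<^esub> \<noteq> \<one>\<^bsub>Q\<^esub>"
    using t' Q.plus_zero[OF c[of t]] Q.plus_one[OF c[of t]] by auto
  define S where "S = term_val Q g' ` subterms t"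
  have S: "finite S" "S \<subseteq> carrier Q" using finite_subterms c by (auto simp: S_def)
  obtain \<phi> where \<phi>: "\<phi> \<zero>\<^bsub>Q\<^esub> = 0" "\<phi> \<one>\<^bsub>Q\<^esub> = 1" "\<And>x. x \<in> S \<Longrightarrow> 0 \<le> \<phi> x" "\<And>x. x \<in> S \<Longrightarrow> \<phi> x \<le> (1::real)"
    "\<And>x. x \<in> S \<Longrightarrow> \<phi> x = 0 \<Longrightarrow> x = \<zero>\<^bsub>Q\<^esub>"
    "\<And>x. x \<in> S \<Longrightarrow> \<sim>\<^bsub>Q\<^esub> x \<in> S \<Longrightarrow> \<phi> (\<sim>\<^bsub>Q\<^esub> x) = 1 - \<phi> x"
    "\<And>x y. x \<in> S \<Longrightarrow> y \<in> S \<Longrightarrow> x \<oplus>\<^bsub>Q\<^esub> y \<in> S \<Longrightarrow> \<phi> (x \<oplus>\<^bsub>Q\<^esub> y) = min 1 (\<phi> x + \<phi> y)"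
    "\<And>x k. x \<in> S \<Longrightarrow> 1 \<le> k \<Longrightarrow> k \<le> delta_bound t \<Longrightarrow> \<delta>\<^bsub>Q\<^esub> k x \<in> S \<Longrightarrow> \<phi> (\<delta>\<^bsub>Q\<^esub> k x) = \<phi> x / real k"
    using Q.chain_local_embedding[OF S nontriv, where n = "delta_bound t"] by blast
  \<comment> \<open>variables outside \<open>t\<close> may have values outside \<open>S\<close>, where \<open>\<phi>\<close> is arbitrary\<close>
  define r where "r v = max 0 (min 1 (\<phi> (g' v)))" for v
  have "term_val unit_dmv r s = \<phi> (term_val Q g' s)"
    if "term_val Q g' ` subterms s \<subseteq> S" "delta_bound s \<le> delta_bound t" for s
    using that
  proof (induction s)
    case (TVar v)
    then show ?case using \<phi>(3,4)[of "g' v"] by (simp add: r_def)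
  next
    case (TNeg s)
    then show ?case using \<phi>(6)[of "term_val Q g' s"] subterms_self[of s] by auto
  next
    case (TPlus s s')
    then show ?case
      using \<phi>(7)[of "term_val Q g' s" "term_val Q g' s'"] subterms_self[of s] subterms_self[of s']
      by (simp add: image_Un image_subset_iff)
  next
    case (TDelta k s)
    then show ?case
      using \<phi>(8)[of "term_val Q g' s" "Suc k"] subterms_self[of s] by auto
  qed (simp_all add: \<phi>(1,2))
  moreover have "term_val Q g' t \<in> S" using subterms_self by (auto simp: S_def)
  ultimately have "term_val unit_dmv r t \<noteq> 0" using \<phi>(5) t' by (auto simp: S_def)
  moreover have "range r \<subseteq> {0..1}" by (auto simp: r_def)
  ultimately show ?thesis by blast
qed

lemma term_val_free: "term_val free_dmv (\<lambda>v. tclass (TVar v)) s = tclass s"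
  by (induction s) (simp_all add: free_dmv_simps)

text \<open>The two inequalities \<open>s \<le> t\<close> and \<open>t \<le> s\<close> in the free algebra are equations \<open>s \<ominus> t = \<zero>\<close> and
  \<open>t \<ominus> s = \<zero>\<close>, so it suffices to refute terms with a nonzero value.\<close>

theorem dmv_completeness:
  fixes s t :: "'v dmv_term"
  assumes eq: "\<And>r. range r \<subseteq> {0..1} \<Longrightarrow> term_val unit_dmv r s = term_val unit_dmv r t"
  shows "s \<approx>\<^sub>d t"
proof -
  interpret F: dmv_algebra "free_dmv :: 'v dmv_term set dmv" by (rule dmv_algebra_free_dmv)
  have c: "range (\<lambda>v::'v. tclass (TVar v)) \<subseteq> carrier free_dmv" "tclass u \<in> carrier free_dmv"
    for u :: "'v dmv_term" by (auto simp: free_dmv_simps)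
  have le: "F.mv_le (tclass s) (tclass t)"
    if eq: "\<And>r. range r \<subseteq> {0..1} \<Longrightarrow> term_val unit_dmv r s = term_val unit_dmv r t"
    for s t :: "'v dmv_term"
  proof (rule ccontr)
    assume "\<not> F.mv_le (tclass s) (tclass t)"
    then have "F.mv_minus (tclass s) (tclass t) \<noteq> \<zero>\<^bsub>free_dmv\<^esub>"
      using F.minus_eq_zero_iff c by simp
    then have "term_val free_dmv (\<lambda>v. tclass (TVar v)) (TNeg (TPlus (TNeg s) t)) \<noteq> \<zero>\<^bsub>free_dmv\<^esub>"
      unfolding term_val_free by (simp add: F.mv_minus_def free_dmv_simps)
    then obtain r where r: "range r \<subseteq> {0..1}"
      "term_val unit_dmv r (TNeg (TPlus (TNeg s) t)) \<noteq> 0"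
      using term_nonzero_real[OF F.dmv_algebra_axioms c(1)] by blast
    then show False using eq[OF r(1)] by simp
  qed
  have "tclass s = tclass t" using le[OF eq] le[OF eq[symmetric]] c by (intro F.le_antisym) auto
  then show ?thesis by (simp add: tclass_eq_iff)
qed

section \<open>Term functions are rational piecewise linear\<close>

definition affine_fun :: "('n \<Rightarrow> rat) \<times> rat \<Rightarrow> real^'n \<Rightarrow> real" where
  "affine_fun p x = of_rat (snd p) + (\<Sum>j\<in>UNIV. of_rat (fst p j) * x $ j)"

text \<open>Finite sets of pieces are easier to combine than families indexed by an initial segment of the
  natural numbers.\<close>

lemma rational_pwl_iff:
  "rational_pwl (f :: real^'n \<Rightarrow> real) \<longleftrightarrow>
    (\<exists>P. finite P \<and> (\<forall>x\<in>unit_cube. \<exists>p\<in>P. f x = affine_fun p x))"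
proof
  assume "rational_pwl f"
  then obtain k :: nat and a :: "nat \<Rightarrow> 'n \<Rightarrow> rat" and b :: "nat \<Rightarrow> rat" where
    *: "\<And>x. x \<in> unit_cube \<Longrightarrow> \<exists>i<k. f x = of_rat (b i) + (\<Sum>j\<in>UNIV. of_rat (a i j) * x $ j)"
    unfolding rational_pwl_def by blast
  show "\<exists>P. finite P \<and> (\<forall>x\<in>unit_cube. \<exists>p\<in>P. f x = affine_fun p x)"
    using * by (intro exI[of _ "(\<lambda>i. (a i, b i)) ` {..<k}"]) (auto simp: affine_fun_def)
next
  assume "\<exists>P. finite P \<and> (\<forall>x\<in>unit_cube. \<exists>p\<in>P. f x = affine_fun p x)"
  then obtain ps where ps: "\<And>x. x \<in> unit_cube \<Longrightarrow> \<exists>p\<in>set ps. f x = affine_fun p x"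
    by (metis finite_list)
  have "\<exists>i<length ps. f x = affine_fun (ps ! i) x" if "x \<in> unit_cube" for x
    using ps[OF that] by (metis in_set_conv_nth)
  then show "rational_pwl f"
    unfolding rational_pwl_def affine_fun_def
    by (intro exI[of _ "length ps"] exI[of _ "\<lambda>i. fst (ps ! i)"] exI[of _ "\<lambda>i. snd (ps ! i)"]) simp
qed

lemma mem_unit_cube: "x \<in> unit_cube \<longleftrightarrow> (\<forall>j. 0 \<le> x $ j \<and> x $ j \<le> 1)"
  by (auto simp: mem_box_cart)

abbreviation term_at :: "'n dmv_term \<Rightarrow> real^'n \<Rightarrow> real" where
  "term_at t x \<equiv> term_val unit_dmv (\<lambda>j. x $ j) t"

lemma term_at_bounds: "x \<in> unit_cube \<Longrightarrow> 0 \<le> term_at t x \<and> term_at t x \<le> 1"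
  using dmv_algebra.term_val_closed[OF dmv_algebra_unit_dmv, of "\<lambda>j. x $ j" t]
  by (force simp: mem_unit_cube)

lemma continuous_term_at: "continuous_on S (term_at t)"
  by (induction t) (auto intro!: continuous_intros)

lemma affine_fun_simps:
  "affine_fun (\<lambda>j. - fst p j, 1 - snd p) x = 1 - affine_fun p x"
  "affine_fun (\<lambda>j. fst p j + fst q j, snd p + snd q) x = affine_fun p x + affine_fun q x"
  "affine_fun (\<lambda>j. fst p j / of_nat m, snd p / of_nat m) x = affine_fun p x / real m"
  "affine_fun (\<lambda>j. 0, c) x = of_rat c"
  "affine_fun (\<lambda>j. if j = i then 1 else 0, 0) x = x $ i"
proof -
  have "of_rat (if j = i then 1 else 0) * x $ j = (if j = i then x $ j else 0)" for j by simp
  then show "affine_fun (\<lambda>j. if j = i then 1 else 0, 0) x = x $ i"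
    by (simp add: affine_fun_def)
qed (simp_all add: affine_fun_def of_rat_add of_rat_diff of_rat_minus of_rat_divide sum_negf
  sum.distrib distrib_right add_divide_distrib sum_divide_distrib)

lemma rational_pwl_term_at: "rational_pwl (term_at t)"
proof (induction t)
  case (TVar i)
  show ?case unfolding rational_pwl_iff
    by (intro exI[of _ "{(\<lambda>j. if j = i then 1 else 0, 0)}"]) (simp add: affine_fun_simps)
next
  case TZero
  show ?case unfolding rational_pwl_iff
    by (intro exI[of _ "{(\<lambda>j. 0, 0)}"]) (simp add: affine_fun_simps)
next
  case TOne
  show ?case unfolding rational_pwl_iff
    by (intro exI[of _ "{(\<lambda>j. 0, 1)}"]) (simp add: affine_fun_simps)
next
  case (TNeg s)
  then obtain P where "finite P" "\<forall>x\<in>unit_cube. \<exists>p\<in>P. term_at s x = affine_fun p x"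
    unfolding rational_pwl_iff by blast
  then show ?case unfolding rational_pwl_iff
    by (intro exI[of _ "(\<lambda>p. (\<lambda>j. - fst p j, 1 - snd p)) ` P"]) (auto simp: affine_fun_simps)
next
  case (TPlus s t)
  then obtain P P' where P: "finite P" "\<And>x. x\<in>unit_cube \<Longrightarrow> \<exists>p\<in>P. term_at s x = affine_fun p x"
    and P': "finite P'" "\<And>x. x\<in>unit_cube \<Longrightarrow> \<exists>p\<in>P'. term_at t x = affine_fun p x"
    unfolding rational_pwl_iff by blast
  let ?P = "insert (\<lambda>j. 0, 1) ((\<lambda>(p, q). (\<lambda>j. fst p j + fst q j, snd p + snd q)) ` (P \<times> P'))"
  show ?case unfolding rational_pwl_iff
  proof (intro exI[of _ ?P] conjI ballI)
    fix x :: "real^'a" assume x: "x \<in> unit_cube"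
    obtain p q where "p \<in> P" "q \<in> P'" "term_at s x = affine_fun p x" "term_at t x = affine_fun q x"
      using P P' x by blast
    then show "\<exists>p\<in>?P. term_at (TPlus s t) x = affine_fun p x"
      by (auto simp: min_def affine_fun_simps)
  qed (use P P' in auto)
next
  case (TDelta k s)
  then obtain P where "finite P" "\<forall>x\<in>unit_cube. \<exists>p\<in>P. term_at s x = affine_fun p x"
    unfolding rational_pwl_iff by blast
  then show ?case unfolding rational_pwl_iff
    by (intro exI[of _ "(\<lambda>p. (\<lambda>j. fst p j / of_nat (Suc k), snd p / of_nat (Suc k))) ` P"])
       (auto simp: affine_fun_simps simp del: of_nat_Suc)
qed

section \<open>Rational piecewise linear functions are term functions\<close>

definition definable :: "(real^'n \<Rightarrow> real) \<Rightarrow> bool" where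
  "definable f \<longleftrightarrow> (\<exists>t. \<forall>x\<in>unit_cube. term_at t x = f x)"

lemma definable_bounds: "definable f \<Longrightarrow> x \<in> unit_cube \<Longrightarrow> 0 \<le> f x \<and> f x \<le> 1"
  using term_at_bounds unfolding definable_def by metis

lemma definable_cong: "definable f \<Longrightarrow> (\<And>x. x \<in> unit_cube \<Longrightarrow> f x = g x) \<Longrightarrow> definable g"
  unfolding definable_def by auto

lemma definable_var: "definable (\<lambda>x. x $ j)"
  unfolding definable_def by (intro exI[of _ "TVar j"]) simp

lemma definable_zero: "definable (\<lambda>x. 0)"
  unfolding definable_def by (intro exI[of _ TZero]) simp

lemma definable_one: "definable (\<lambda>x. 1)"
  unfolding definable_def by (intro exI[of _ TOne]) simp

lemma definable_neg: "definable f \<Longrightarrow> definable (\<lambda>x. 1 - f x)"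
  unfolding definable_def using term_val.simps(4)[of unit_dmv] by (metis unit_dmv_simps(3))

lemma definable_plus: "definable f \<Longrightarrow> definable g \<Longrightarrow> definable (\<lambda>x. min 1 (f x + g x))"
  unfolding definable_def using term_val.simps(5)[of unit_dmv] by (metis unit_dmv_simps(2))

lemma definable_delta: "definable f \<Longrightarrow> definable (\<lambda>x. f x / real (Suc k))"
  unfolding definable_def using term_val.simps(6)[of unit_dmv] by (metis unit_dmv_simps(6))

lemma definable_add:
  assumes "definable f" "definable g" "\<And>x. x \<in> unit_cube \<Longrightarrow> f x + g x \<le> 1"
  shows "definable (\<lambda>x. f x + g x)"
  by (rule definable_cong[OF definable_plus[OF assms(1,2)]]) (use assms(3) in auto)

lemma definable_minus:
  assumes "definable f" "definable g"
  shows "definable (\<lambda>x. max 0 (f x - g x))"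
  by (rule definable_cong[OF definable_neg[OF definable_plus[OF definable_neg[OF assms(1)] assms(2)]]])
     (auto simp: max_def min_def)

lemma definable_max:
  assumes "definable f" "definable g"
  shows "definable (\<lambda>x. max (f x) (g x))"
  by (rule definable_cong[OF definable_plus[OF definable_minus[OF assms] assms(2)]])
     (use definable_bounds[OF assms(1)] definable_bounds[OF assms(2)] in \<open>force simp: max_def min_def\<close>)

lemma definable_min:
  assumes "definable f" "definable g"
  shows "definable (\<lambda>x. min (f x) (g x))"
  by (rule definable_cong[OF definable_neg[OF definable_max[OF assms[THEN definable_neg]]]])
     (auto simp: max_def min_def)

lemma definable_Max:
  assumes "finite I" "I \<noteq> {}" "\<And>i. i \<in> I \<Longrightarrow> definable (f i)"
  shows "definable (\<lambda>x. Max ((\<lambda>i. f i x) ` I))"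
  using assms by (induction I rule: finite_ne_induct) (auto intro: definable_max)

lemma definable_Min:
  assumes "finite I" "I \<noteq> {}" "\<And>i. i \<in> I \<Longrightarrow> definable (f i)"
  shows "definable (\<lambda>x. Min ((\<lambda>i. f i x) ` I))"
  using assms by (induction I rule: finite_ne_induct) (auto intro: definable_min)

lemma definable_scale:
  assumes f: "definable f" and q: "q \<in> \<rat>" "0 \<le> q" "q \<le> 1"
  shows "definable (\<lambda>x. q * f x)"
proof -
  obtain m n :: nat where n: "n \<noteq> 0" and "\<bar>q\<bar> = real m / real n"
    using Rats_abs_nat_div_natE[OF q(1)] by metis
  then have qmn: "q = real m / real n" using q by simp
  then have "real m \<le> real n" using q(3) n by (simp add: pos_divide_le_eq)
  then have mn: "m \<le> n" by simp
  obtain k where k: "n = Suc k" using n by (cases n) auto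
  have "definable (\<lambda>x. real i / real n * f x)" if "i \<le> n" for i
    using that
  proof (induction i)
    case 0
    then show ?case using definable_zero by simp
  next
    case (Suc i)
    have "definable (\<lambda>x. real i / real n * f x + f x / real n)"
    proof (rule definable_add)
      show "definable (\<lambda>x. f x / real n)" using definable_delta[OF f, of k] k by simp
      fix x :: "real^'a" assume x: "x \<in> unit_cube"
      have "real (Suc i) / real n * f x \<le> 1 * 1"
        using Suc.prems definable_bounds[OF f x] n by (intro mult_mono) auto
      then show "real i / real n * f x + f x / real n \<le> 1"
        by (simp add: distrib_right add_divide_distrib add.commute)
    qed (use Suc in auto)
    then show ?case
      by (rule definable_cong) (simp add: distrib_right add_divide_distrib add.commute)
  qed
  then show ?thesis using mn qmn by simp
qed

lemma definable_mult:
  assumes f: "definable f"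
  shows "definable (\<lambda>x. min 1 (real k * f x))"
proof (induction k)
  case 0
  then show ?case using definable_zero by simp
next
  case (Suc k)
  show ?case
    by (rule definable_cong[OF definable_plus[OF Suc f]])
       (use definable_bounds[OF f] in \<open>force simp: min_def algebra_simps\<close>)
qed

text \<open>With \<open>N\<close> at least the sum of the absolute values of the coefficients, \<open>1/2 + p/(2N)\<close> and all
  its partial sums stay in \<open>[0,1]\<close> on the cube, so they are definable one summand at a time.
  Subtracting \<open>1/2\<close> with truncation at \<open>0\<close> gives \<open>max 0 p / (2N)\<close>, and the \<open>2N\<close>-fold truncated sum of
  this is the truncation of \<open>p\<close>.\<close>

lemma definable_clamp_affine: "definable (\<lambda>x. max 0 (min 1 (affine_fun p x)))"
proof -
  define a :: "'a \<Rightarrow> real" where "a j = of_rat (fst p j)" for j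
  define b :: real where "b = of_rat (snd p)"
  define B where "B = \<bar>b\<bar> + (\<Sum>j\<in>UNIV. \<bar>a j\<bar>)"
  obtain N :: nat where N: "max 1 B \<le> real N" using real_arch_simple by blast
  then have "0 < N" by (cases N) auto
  define q where "q j = a j / (2 * real N)" for j
  define c where "c = 1/2 + b / (2 * real N)"
  have rat: "q j \<in> \<rat>" "c \<in> \<rat>" for j by (auto simp: q_def c_def a_def b_def)
  have part: "0 \<le> c + (\<Sum>j\<in>J. q j * x $ j) \<and> c + (\<Sum>j\<in>J. q j * x $ j) \<le> 1"
    if x: "x \<in> unit_cube" for J x
  proof -
    have "\<bar>\<Sum>j\<in>J. a j * x $ j\<bar> \<le> (\<Sum>j\<in>J. \<bar>a j * x $ j\<bar>)" by (rule sum_abs)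
    also have "\<dots> \<le> (\<Sum>j\<in>J. \<bar>a j\<bar>)"
      using x by (intro sum_mono) (auto simp: abs_mult mem_unit_cube intro: mult_left_le)
    also have "\<dots> \<le> (\<Sum>j\<in>UNIV. \<bar>a j\<bar>)" by (intro sum_mono2) auto
    finally have "\<bar>b + (\<Sum>j\<in>J. a j * x $ j)\<bar> \<le> real N" using N unfolding B_def by linarith
    moreover have "c + (\<Sum>j\<in>J. q j * x $ j) = 1/2 + (b + (\<Sum>j\<in>J. a j * x $ j)) / (2 * real N)"
      by (simp add: c_def q_def sum_divide_distrib add_divide_distrib)
    moreover have "0 < real N" using N by simp
    ultimately show ?thesis by (simp only:) (simp add: field_simps abs_le_iff)
  qed
  have "definable (\<lambda>x. c + (\<Sum>j\<in>J. q j * x $ j))" if "finite J" for J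
    using that
  proof (induction J)
    case empty
    then show ?case using definable_scale[OF definable_one rat(2)] part[of 0 "{}"]
      by (simp add: mem_unit_cube)
  next
    case (insert i J)
    have "\<bar>a i\<bar> \<le> (\<Sum>j\<in>UNIV. \<bar>a j\<bar>)" by (rule member_le_sum) auto
    then have "\<bar>a i\<bar> \<le> 2 * real N" using N unfolding B_def by linarith
    then have qi: "\<bar>q i\<bar> \<le> 1" using N by (simp add: q_def)
    have d: "definable (\<lambda>x. \<bar>q i\<bar> * x $ i)" using rat qi by (intro definable_scale definable_var) auto
    have step: "c + (\<Sum>j\<in>insert i J. q j * x $ j) = (c + (\<Sum>j\<in>J. q j * x $ j)) + q i * x $ i" for x
      using insert.hyps by simp
    show ?case
    proof (cases "q i \<ge> 0")
      case True
      have "definable (\<lambda>x. (c + (\<Sum>j\<in>J. q j * x $ j)) + \<bar>q i\<bar> * x $ i)"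
        using True part[of _ "insert i J"] step
        by (intro definable_add insert.IH d) simp
      then show ?thesis by (rule definable_cong) (simp add: step True)
    next
      case False
      have "definable (\<lambda>x. max 0 ((c + (\<Sum>j\<in>J. q j * x $ j)) - \<bar>q i\<bar> * x $ i))"
        by (intro definable_minus insert.IH d)
      then show ?thesis
        by (rule definable_cong) (use False part[of _ "insert i J"] step in simp)
    qed
  qed
  then have "definable (\<lambda>x. c + (\<Sum>j\<in>UNIV. q j * x $ j))" by simp
  then have "definable (\<lambda>x. max 0 ((c + (\<Sum>j\<in>UNIV. q j * x $ j)) - 1/2 * 1))"
    by (intro definable_minus definable_scale definable_one) auto
  then have "definable (\<lambda>x. min 1 (real (2 * N) * max 0 ((c + (\<Sum>j\<in>UNIV. q j * x $ j)) - 1/2 * 1)))"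
    by (rule definable_mult)
  then show ?thesis
  proof (rule definable_cong)
    fix x :: "real^'a"
    have "(c + (\<Sum>j\<in>UNIV. q j * x $ j)) - 1/2 * 1 = affine_fun p x / (2 * real N)"
      by (simp add: c_def q_def a_def b_def affine_fun_def sum_divide_distrib add_divide_distrib)
    moreover have "min 1 (real (2 * N) * max 0 (v / (2 * real N))) = max 0 (min 1 v)" for v
      using \<open>0 < N\<close> by (auto simp: max_def min_def zero_le_divide_iff)
    ultimately show "min 1 (real (2 * N) * max 0 ((c + (\<Sum>j\<in>UNIV. q j * x $ j)) - 1/2 * 1)) =
        max 0 (min 1 (affine_fun p x))"
      by (simp only:)
  qed
qed

text \<open>Suppose that every piece starting at or below \<open>\<phi> 0\<close> ends below \<open>\<phi> 1\<close>. As there are finitely many,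
  they end below \<open>\<phi> 1 - \<eta>\<close> for some \<open>\<eta> > 0\<close>, so on all of \<open>[0,1]\<close> they stay below the line \<open>l\<close> from
  \<open>\<phi> 0\<close> to \<open>\<phi> 1 - \<eta>\<close>. After the last point \<open>c\<close> with \<open>\<phi> c \<le> l c\<close>, the function uses only pieces
  that start above \<open>\<phi> 0\<close>. One of them is used arbitrarily close to \<open>c\<close>, so it meets \<open>\<phi>\<close> at \<open>c\<close>: it is above
  \<open>l\<close> at \<open>0\<close>, not above \<open>l\<close> at \<open>c\<close>, and above \<open>l\<close> at a later point, which no affine function does.\<close>

lemma affine_selection_segment:
  fixes \<phi> :: "real \<Rightarrow> real" and \<alpha> \<beta> :: "'i \<Rightarrow> real"
  assumes cont: "continuous_on {0..1} \<phi>" and fin: "finite I"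
    and cover: "\<And>t. t \<in> {0..1} \<Longrightarrow> \<exists>i\<in>I. \<phi> t = \<alpha> i + \<beta> i * t"
  shows "\<exists>i\<in>I. \<alpha> i \<le> \<phi> 0 \<and> \<phi> 1 \<le> \<alpha> i + \<beta> i"
proof (rule ccontr)
  assume neg: "\<not> ?thesis"
  define \<eta> where "\<eta> = Min (insert 1 ((\<lambda>i. \<phi> 1 - (\<alpha> i + \<beta> i)) ` {i \<in> I. \<alpha> i \<le> \<phi> 0}))"
  have \<eta>: "\<eta> > 0" unfolding \<eta>_def using fin neg by (subst Min_gr_iff) auto
  have \<eta>_le: "\<alpha> i + \<beta> i \<le> \<phi> 1 - \<eta>" if "i \<in> I" "\<alpha> i \<le> \<phi> 0" for i
  proof -
    have "\<eta> \<le> \<phi> 1 - (\<alpha> i + \<beta> i)" unfolding \<eta>_def using fin that by (intro Min_le) auto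
    then show ?thesis by simp
  qed
  define l where "l t = \<phi> 0 + (\<phi> 1 - \<phi> 0 - \<eta>) * t" for t
  have below: "\<alpha> i + \<beta> i * t \<le> l t" if "i \<in> I" "\<alpha> i \<le> \<phi> 0" "t \<in> {0..1}" for i t
  proof -
    have "(1 - t) * \<alpha> i + t * (\<alpha> i + \<beta> i) \<le> (1 - t) * \<phi> 0 + t * (\<phi> 1 - \<eta>)"
      using that \<eta>_le[of i] by (intro add_mono mult_left_mono) auto
    then show ?thesis by (simp add: l_def algebra_simps)
  qed
  define T where "T = {t \<in> {0..1}. \<phi> t - l t \<le> 0}"
  have "closed T" unfolding T_def l_def
    by (intro continuous_on_closed_Collect_le) (auto intro!: continuous_intros cont)
  moreover have "0 \<in> T" by (simp add: T_def l_def)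
  moreover have "bdd_above T" by (auto simp: T_def bdd_above_def)
  ultimately have "Sup T \<in> T" using closed_contains_Sup[of T] by auto
  define c where "c = Sup T"
  have c: "c \<in> {0..1}" "\<phi> c \<le> l c" using \<open>Sup T \<in> T\<close> by (auto simp: c_def T_def)
  have after: "l t < \<phi> t" if "c < t" "t \<le> 1" for t
    using that c cSup_upper[OF _ \<open>bdd_above T\<close>, of t] by (force simp: c_def T_def)
  have "c < 1" using c \<eta> by (cases "c = 1") (auto simp: l_def)
  define E where "E i = {t \<in> {c<..1}. \<phi> t = \<alpha> i + \<beta> i * t}" for i
  have "{c<..1} \<subseteq> (\<Union>i\<in>I. E i)" using cover c(1) by (force simp: E_def)
  then have "closure {c<..1} \<subseteq> closure (\<Union>i\<in>I. E i)" by (rule closure_mono)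
  also have "\<dots> = (\<Union>i\<in>I. closure (E i))" using fin by (induction rule: finite_induct) simp_all
  finally obtain i where i: "i \<in> I" "c \<in> closure (E i)" using \<open>c < 1\<close> by force
  have "closed {t \<in> {0..1}. \<phi> t - (\<alpha> i + \<beta> i * t) = 0}"
    by (intro continuous_closed_preimage_constant continuous_intros cont)
  moreover have "E i \<subseteq> {t \<in> {0..1}. \<phi> t - (\<alpha> i + \<beta> i * t) = 0}" using c(1) by (auto simp: E_def)
  ultimately have "closure (E i) \<subseteq> {t \<in> {0..1}. \<phi> t - (\<alpha> i + \<beta> i * t) = 0}"
    by (intro closure_minimal)
  then have ic: "\<phi> c = \<alpha> i + \<beta> i * c" using i(2) by auto
  obtain t where t: "t \<in> E i" using i(2) by (cases "E i = {}") auto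
  have above: "\<alpha> i > \<phi> 0"
    using below[OF i(1), of t] after[of t] t c by (force simp: E_def)
  have "\<alpha> i + \<beta> i * t > l t" using after[of t] t by (simp add: E_def)
  moreover have "\<alpha> i + \<beta> i * c \<le> l c" using c ic by simp
  ultimately show False
  proof -
    assume *: "\<alpha> i + \<beta> i * t > l t" "\<alpha> i + \<beta> i * c \<le> l c"
    define k where "k = \<phi> 1 - \<phi> 0 - \<eta> - \<beta> i"
    have "k * t < \<alpha> i - \<phi> 0" "\<alpha> i - \<phi> 0 \<le> k * c" using * by (auto simp: l_def k_def algebra_simps)
    moreover have "k * c \<le> k * t" 
    proof -
      have "0 < k * c" using above calculation by linarith
      then have "k > 0" using c(1) by (auto simp: zero_less_mult_iff)
      then show ?thesis using t by (auto simp: E_def)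
    qed
    ultimately show False by linarith
  qed
qed

lemma affine_selection:
  assumes f: "continuous_on unit_cube f" and P: "finite P"
    "\<And>x. x \<in> unit_cube \<Longrightarrow> \<exists>p\<in>P. f x = affine_fun p x"
    and xy: "x \<in> unit_cube" "y \<in> unit_cube"
  shows "\<exists>p\<in>P. affine_fun p x \<le> f x \<and> f y \<le> affine_fun p y"
proof -
  define z where "z t = x + t *\<^sub>R (y - x)" for t :: real
  have z: "z t \<in> unit_cube" if "t \<in> {0..1}" for t
    using convexD_alt[OF convex_box(1) xy, of t] that by (simp add: z_def algebra_simps)
  have aff: "affine_fun p (z t) = affine_fun p x + (affine_fun p y - affine_fun p x) * t" for p t
    by (simp add: affine_fun_def z_def sum_subtractf sum.distrib algebra_simps sum_distrib_left)
  have "continuous_on {0..1} (f \<circ> z)"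
    by (rule continuous_on_compose)
       (auto simp: z_def[abs_def] intro!: continuous_intros continuous_on_subset[OF f]
        z[unfolded z_def])
  then have "\<exists>p\<in>P. affine_fun p x \<le> (f \<circ> z) 0 \<and> (f \<circ> z) 1 \<le> affine_fun p x + (affine_fun p y - affine_fun p x)"
    using P(2)[OF z] by (intro affine_selection_segment P(1)) (auto simp: aff)
  then show ?thesis by (simp add: z_def)
qed

text \<open>The finitely many sets \<open>up y\<close> of pieces that are at least \<open>f\<close> at \<open>y\<close> give \<open>f\<close> as the maximum
  over \<open>y\<close> of the minima over \<open>up y\<close>. Pieces may leave \<open>[0,1]\<close>, but truncating them does not matter since
  \<open>f\<close> has its values there.\<close>

lemma pwl_definable:
  assumes f: "continuous_on unit_cube f" "rational_pwl f"
    and bound: "\<And>x. x \<in> unit_cube \<Longrightarrow> 0 \<le> f x \<and> f x \<le> 1"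
  shows "definable f"
proof -
  obtain P where P: "finite P" "\<And>x. x \<in> unit_cube \<Longrightarrow> \<exists>p\<in>P. f x = affine_fun p x"
    using f(2) unfolding rational_pwl_iff by blast
  define clamp where "clamp p x = max 0 (min 1 (affine_fun p x))" for p and x :: "real^'a"
  define up where "up y = {p \<in> P. f y \<le> affine_fun p y}" for y
  define \<U> where "\<U> = up ` unit_cube"
  have up: "finite (up y)" for y using P by (simp add: up_def)
  have up_ne: "up y \<noteq> {}" if "y \<in> unit_cube" for y using P(2)[OF that] unfolding up_def by force
  have \<U>: "finite \<U>" by (rule finite_subset[of _ "Pow P"]) (use P in \<open>auto simp: \<U>_def up_def\<close>)
  have "(0::real^'a) \<in> unit_cube" by (simp add: mem_unit_cube)
  then have \<U>_ne: "\<U> \<noteq> {}" by (auto simp: \<U>_def)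
  have "definable (\<lambda>x. Max ((\<lambda>U. Min ((\<lambda>p. clamp p x) ` U)) ` \<U>))"
    using \<U> \<U>_ne up up_ne definable_clamp_affine
    by (intro definable_Max definable_Min) (auto simp: \<U>_def clamp_def)
  then show ?thesis
  proof (rule definable_cong)
    fix x :: "real^'a" assume x: "x \<in> unit_cube"
    show "Max ((\<lambda>U. Min ((\<lambda>p. clamp p x) ` U)) ` \<U>) = f x"
    proof (rule Max_eqI)
      fix v assume "v \<in> (\<lambda>U. Min ((\<lambda>p. clamp p x) ` U)) ` \<U>"
      then obtain y where y: "y \<in> unit_cube" "v = Min ((\<lambda>p. clamp p x) ` up y)" by (auto simp: \<U>_def)
      obtain p where "p \<in> up y" "affine_fun p x \<le> f x"
        using affine_selection[OF f(1) P x y(1)] by (auto simp: up_def)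
      then have "v \<le> clamp p x"
        unfolding y(2) using up by (intro Min_le) auto
      moreover have "clamp p x \<le> f x"
        using \<open>affine_fun p x \<le> f x\<close> bound[OF x] by (auto simp: clamp_def)
      ultimately show "v \<le> f x" by linarith
    next
      obtain p where p: "p \<in> up x" "affine_fun p x = f x" using P(2)[OF x] by (auto simp: up_def)
      have "Min ((\<lambda>p. clamp p x) ` up x) = f x"
      proof (rule Min_eqI)
        show "f x \<in> (\<lambda>p. clamp p x) ` up x"
          using p bound[OF x] by (intro image_eqI[of _ _ p]) (auto simp: clamp_def)
      qed (use up bound[OF x] in \<open>auto simp: clamp_def up_def\<close>)
      then show "f x \<in> (\<lambda>U. Min ((\<lambda>p. clamp p x) ` U)) ` \<U>" using x by (force simp: \<U>_def)
    qed (use \<U> in auto)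
  qed
qed

section \<open>The isomorphism\<close>

theorem theorem4p5:
  shows "dmv_iso (free_dmv :: ('n::finite) dmv_term set dmv) (pwl_dmv :: (real^'n \<Rightarrow> real) dmv)"
proof -
  define term_fun :: "'n dmv_term \<Rightarrow> real^'n \<Rightarrow> real"
    where "term_fun t = (\<lambda>x\<in>unit_cube. term_at t x)" for t
  define h where "h X = term_fun (SOME s. X = tclass s)" for X
  have term_fun_eq: "term_fun s = term_fun t \<longleftrightarrow> s \<approx>\<^sub>d t" for s t
  proof
    assume "s \<approx>\<^sub>d t"
    then show "term_fun s = term_fun t"
      using dmv_algebra.term_val_sound[OF dmv_algebra_unit_dmv]
      unfolding term_fun_def by (intro restrict_ext) (auto simp: mem_unit_cube image_subset_iff)
  next
    assume eq: "term_fun s = term_fun t"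
    show "s \<approx>\<^sub>d t"
    proof (rule dmv_completeness)
      fix r :: "'n \<Rightarrow> real" assume "range r \<subseteq> {0..1}"
      then have "(\<chi> j. r j) \<in> unit_cube" by (auto simp: mem_unit_cube image_subset_iff)
      then show "term_val unit_dmv r s = term_val unit_dmv r t"
        using fun_cong[OF eq, of "\<chi> j. r j"] by (simp add: term_fun_def vec_lambda_inverse)
    qed
  qed
  have h: "h (tclass s) = term_fun s" for s
  proof -
    have "tclass s = tclass (SOME s'. tclass s = tclass s')" by (rule someI) simp
    then show ?thesis unfolding h_def by (simp add: term_fun_eq tclass_eq_iff dmv_eq.sym)
  qed
  have closed: "term_fun t \<in> carrier pwl_dmv" for t
  proof -
    have "continuous_on unit_cube (term_fun t)"
      using continuous_term_at[of unit_cube t] by (simp add: term_fun_def)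
    moreover have "rational_pwl (term_fun t)"
      using rational_pwl_term_at[of t] by (simp add: rational_pwl_def term_fun_def)
    ultimately show ?thesis
      using term_at_bounds[of _ t] by (force simp: pwl_dmv_def term_fun_def)
  qed
  have surj: "f \<in> range term_fun" if "f \<in> carrier pwl_dmv" for f
  proof -
    have f: "f \<in> unit_cube \<rightarrow>\<^sub>E {0..1}" "continuous_on unit_cube f" "rational_pwl f"
      using that by (auto simp: pwl_dmv_def)
    then have "definable f" by (intro pwl_definable) (auto simp: PiE_iff)
    then obtain t where "\<forall>x\<in>unit_cube. term_at t x = f x" by (auto simp: definable_def)
    then have "f x = term_fun t x" for x
      using PiE_arb[OF f(1), of x] by (cases "x \<in> unit_cube") (simp_all add: term_fun_def)
    then have "f = term_fun t" by blast
    then show ?thesis by blast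
  qed
  have "h \<in> dmv_hom free_dmv pwl_dmv"
    unfolding dmv_hom_def
  proof (intro CollectI conjI ballI allI impI)
    show "h \<in> carrier free_dmv \<rightarrow> carrier pwl_dmv" by (auto simp: free_dmv_simps h closed)
    fix X :: "'n dmv_term set" assume "X \<in> carrier free_dmv"
    then obtain s where X: "X = tclass s" by (auto simp: free_dmv_simps)
    show "h (\<sim>\<^bsub>free_dmv\<^esub> X) = \<sim>\<^bsub>pwl_dmv\<^esub> h X"
      unfolding X free_dmv_simps h by (auto simp: pwl_dmv_def term_fun_def fun_eq_iff)
    show "h (\<delta>\<^bsub>free_dmv\<^esub> m X) = \<delta>\<^bsub>pwl_dmv\<^esub> m (h X)" if "m \<ge> 1" for m
      unfolding X free_dmv_simps h using that by (auto simp: pwl_dmv_def term_fun_def fun_eq_iff)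
    fix Y :: "'n dmv_term set" assume "Y \<in> carrier free_dmv"
    then obtain t where Y: "Y = tclass t" by (auto simp: free_dmv_simps)
    show "h (X \<oplus>\<^bsub>free_dmv\<^esub> Y) = h X \<oplus>\<^bsub>pwl_dmv\<^esub> h Y"
      unfolding X Y free_dmv_simps h by (auto simp: pwl_dmv_def term_fun_def fun_eq_iff)
  qed (simp_all add: free_dmv_simps h, simp_all add: pwl_dmv_def term_fun_def)
  moreover have "bij_betw h (carrier free_dmv) (carrier pwl_dmv)"
    unfolding bij_betw_def
  proof
    show "inj_on h (carrier free_dmv)"
      by (auto simp: inj_on_def free_dmv_simps h term_fun_eq tclass_eq_iff)
    show "h ` carrier free_dmv = carrier pwl_dmv"
      using closed surj by (auto simp: free_dmv_simps h image_image)
  qed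
  ultimately show ?thesis unfolding dmv_iso_def by blast
qed

end
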